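(* Let $G=(V,E)$ be a simple, strongly connected and balanced directed graph on $V=\{1,\dots,n\}$, with Laplacian $L$ and resistance matrix $R=[r_{ij}]$. Then: (i) for all non-empty $\Omega_1,\Omega_2\subseteq\{1,\dots,n\}$ with $\eta:=|\Omega_1|=|\Omega_2|$, \[\operatorname{cofsum}(R[\Omega_1,\Omega_2])=(-1)^{\alpha(\Omega_1)+\alpha(\Omega_2)+\eta-1}\frac{2^{\eta-1}}{\kappa(G)}\det\big(L[\Omega_2^c,\Omega_1^c]\big);\] (ii) for all distinct $i,j\in\{1,\dots,n\}$, \[r_{ij}+r_{ji}=\frac{2}{\kappa(G)}\det\big(L[\{i,j\}^c,\{i,j\}^c]\big).\]
   Context: For a simple directed graph $G=(V,E)$, the adjacency matrix is $A=[a_{ij}]$ with $a_{ij}=1$ if $(i,j)\in E$ and $0$ otherwise. $G$ is balanced if every vertex has indegree equal to outdegree; strongly connected if every ordered pair of vertices is joined by a directed path. The Laplacian is $L=\operatorname{Diag}(A\mathbf{1})-A$ ($\mathbf{1}$ the all-ones vector). With $L^\dagger=[l^\dagger_{ij}]$ the Moore–Penrose inverse, $r_{ij}=l^\dagger_{ii}+l^\dagger_{jj}-2l^\dagger_{ij}$ and $R=[r_{ij}]$. An oriented spanning tree rooted at $i$ is a spanning subgraph with no oriented cycles in which $i$ has outdegree $0$ and every other vertex has outdegree $1$; for strongly connected balanced $G$ their number does not depend on $i$ and is denoted $\kappa(G)$. $W[\Omega_1,\Omega_2]$ is the submatrix with rows indexed by $\Omega_1$ and columns by $\Omega_2$; $\Omega^c$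 is the complement in $\{1,\dots,n\}$; $\alpha(\Omega)$ is the sum of the elements of $\Omega$. $\operatorname{cofsum}(B)=\mathbf{1}'\operatorname{adj}(B)\mathbf{1}$ is the sum of all cofactors of $B$. The determinant of a $0\times0$ matrix is $1$. *)

theory Defs
  imports
    "Jordan_Normal_Form.Determinant"
    "Jordan_Normal_Form.DL_Submatrix"
    "Graph_Theory.Graph_Theory"
    Complex_Main
begin

section \<open>Matrices\<close>

definition ones_vec :: "nat \<Rightarrow> real vec" where
  "ones_vec n = vec n (\<lambda>_. 1)"

definition cofsum :: "real mat \<Rightarrow> real" where
  "cofsum B = ones_vec (dim_row B) \<bullet> (adj_mat B *\<^sub>v ones_vec (dim_col B))"

text \<open>
  Matrices are indexed from 0 and vertices from 1: row and column \<open>i\<close> of a matrix belong to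
  the vertex \<open>Suc i\<close>.  The index sets \<open>\<Omega>1\<close>, \<open>\<Omega>2\<close> below are sets of vertices.
\<close>

definition vsubmatrix :: "'a mat \<Rightarrow> nat set \<Rightarrow> nat set \<Rightarrow> 'a mat" where
  "vsubmatrix W \<Omega>1 \<Omega>2 = submatrix W {i. Suc i \<in> \<Omega>1} {j. Suc j \<in> \<Omega>2}"

definition is_moore_penrose :: "real mat \<Rightarrow> real mat \<Rightarrow> bool" where
  "is_moore_penrose A X \<longleftrightarrow>
     X \<in> carrier_mat (dim_col A) (dim_row A) \<and>
     A * X * A = A \<and>
     X * A * X = X \<and>
     transpose_mat (A * X) = A * X \<and>
     transpose_mat (X * A) = X * A"

definition moore_penrose :: "real mat \<Rightarrow> real mat" where
  "moore_penrose A = (THE X. is_moore_penrose A X)"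

lemma is_moore_penrose_unique:
  assumes X: "is_moore_penrose A X" and Y: "is_moore_penrose A Y"
  shows "X = Y"
proof -
  define m n where "m = dim_row A" and "n = dim_col A"
  have A: "A \<in> carrier_mat m n"
    by (simp add: m_def n_def)
  have Xc: "X \<in> carrier_mat n m" and Yc: "Y \<in> carrier_mat n m"
    using X Y by (auto simp: is_moore_penrose_def m_def n_def)
  have X1: "A * X * A = A" and X2: "X * A * X = X"
    and X3: "transpose_mat (A * X) = A * X" and X4: "transpose_mat (X * A) = X * A"
    and Y1: "A * Y * A = A" and Y2: "Y * A * Y = Y"
    and Y3: "transpose_mat (A * Y) = A * Y" and Y4: "transpose_mat (Y * A) = Y * A"
    using X Y by (auto simp: is_moore_penrose_def)
  have AXc: "A * X \<in> carrier_mat m m" and AYc: "A * Y \<in> carrier_mat m m"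
    and XAc: "X * A \<in> carrier_mat n n" and YAc: "Y * A \<in> carrier_mat n n"
    using A Xc Yc by auto
  have "A * X = (A * Y * A) * X"
    by (simp add: Y1)
  also have "\<dots> = (A * Y) * (A * X)"
    using AYc A Xc by (rule assoc_mult_mat)
  finally have AX: "A * X = (A * Y) * (A * X)" .
  have "A * X = transpose_mat ((A * Y) * (A * X))"
    using AX X3 by simp
  also have "\<dots> = (A * X) * (A * Y)"
    using transpose_mult[OF AYc AXc] X3 Y3 by simp
  also have "\<dots> = (A * X * A) * Y"
    using assoc_mult_mat[OF AXc A Yc] by simp
  finally have AXY: "A * X = A * Y"
    by (simp add: X1)
  have "X * A = X * (A * (Y * A))"
    using assoc_mult_mat[OF A Yc A] Y1 by simp
  also have "\<dots> = (X * A) * (Y * A)"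
    using assoc_mult_mat[OF Xc A YAc] by simp
  finally have XA: "X * A = (X * A) * (Y * A)" .
  have "X * A = transpose_mat ((X * A) * (Y * A))"
    using XA X4 by simp
  also have "\<dots> = (Y * A) * (X * A)"
    using transpose_mult[OF XAc YAc] X4 Y4 by simp
  also have "\<dots> = Y * (A * (X * A))"
    using assoc_mult_mat[OF Yc A XAc] by simp
  also have "\<dots> = Y * A"
    using assoc_mult_mat[OF A Xc A] X1 by simp
  finally have XAY: "X * A = Y * A" .
  have "X = (Y * A) * X"
    using X2 XAY by simp
  also have "\<dots> = Y * (A * Y)"
    using assoc_mult_mat[OF Yc A Xc] AXY by simp
  also have "\<dots> = Y"
    using assoc_mult_mat[OF Yc A Yc] Y2 by simp
  finally show ?thesis .
qed

lemma moore_penrose_eqI: "is_moore_penrose A X \<Longrightarrow> moore_penrose A = X"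
  unfolding moore_penrose_def using is_moore_penrose_unique by blast


section \<open>Digraphs on the vertex set \<open>{1..n}\<close>\<close>

definition balanced :: "nat pair_pre_digraph \<Rightarrow> bool" where
  "balanced G \<longleftrightarrow> (\<forall>v \<in> pverts G. in_degree G v = out_degree G v)"

definition adjacency_matrix :: "nat pair_pre_digraph \<Rightarrow> real mat" where
  "adjacency_matrix G =
     mat (card (pverts G)) (card (pverts G)) (\<lambda>(i, j). if (Suc i, Suc j) \<in> parcs G then 1 else 0)"

definition laplacian :: "nat pair_pre_digraph \<Rightarrow> real mat" where
  "laplacian G =
     (let n = card (pverts G); A = adjacency_matrix G
      in mat_diag n (\<lambda>i. (A *\<^sub>v ones_vec n) $ i) - A)"

definition resistance :: "nat pair_pre_digraph \<Rightarrow> nat \<Rightarrow> nat \<Rightarrow> real" where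
  "resistance G i j =
     (let Ld = moore_penrose (laplacian G)
      in Ld $$ (i - 1, i - 1) + Ld $$ (j - 1, j - 1) - 2 * Ld $$ (i - 1, j - 1))"

definition resistance_matrix :: "nat pair_pre_digraph \<Rightarrow> real mat" where
  "resistance_matrix G =
     mat (card (pverts G)) (card (pverts G)) (\<lambda>(i, j). resistance G (Suc i) (Suc j))"

definition oriented_spanning_tree ::
    "nat pair_pre_digraph \<Rightarrow> nat \<Rightarrow> nat pair_pre_digraph \<Rightarrow> bool" where
  "oriented_spanning_tree G r T \<longleftrightarrow>
     spanning T G \<and>
     (\<nexists>p. pre_digraph.cycle T p) \<and>
     out_degree T r = 0 \<and>
     (\<forall>v \<in> pverts G - {r}. out_degree T v = 1)"

text \<open>
  The number of oriented spanning trees rooted at a vertex, for digraphs where this number is the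
  same for all roots (strongly connected balanced digraphs have this property).
\<close>

definition kappa :: "nat pair_pre_digraph \<Rightarrow> nat" where
  "kappa G = (THE k. \<forall>r \<in> pverts G. card {T. oriented_spanning_tree G r T} = k)"

end

theory Submission
  imports Defs
begin

text \<open>
  Write \<open>J\<close> for the all-ones matrix.  Since \<open>L\<close> has zero row and column sums and its kernel
  consists of the constant vectors, the Moore--Penrose inverse \<open>X\<close> of \<open>L\<close> satisfies
  \<open>(L + s J) (X + t J) = 1\<close> whenever \<open>s t n\<^sup>2 = 1\<close>.  As \<open>det (B + t J) = det B + t cofsum B\<close>,
  Jacobi's identity relating the minors of \<open>L + s J\<close> to the complementary minors of its inverse
  becomes an identity between affine functions of \<open>s\<close>, and its constant term reads
  \<open>(cofsum L / n\<^sup>2) cofsum X[\<Omega>1, \<Omega>2] = \<plusminus> det L[\<Omega>2\<^sup>c, \<Omega>1\<^sup>c]\<close>.  For \<open>\<Omega>1 = \<Omega>2 = {r}\<close> this shows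
  that all principal minors \<open>det L[{r}\<^sup>c, {r}\<^sup>c]\<close> are equal to \<open>cofsum L / n\<^sup>2\<close>; they count the
  oriented spanning trees rooted at \<open>r\<close>, because multilinearity in the rows expands such a minor
  over all choices of one outgoing arc per vertex, and a choice contributes \<open>1\<close> if all vertices
  reach \<open>r\<close> and \<open>0\<close> otherwise.  Finally \<open>R\<close> differs from \<open>- 2 X\<close> by matrices with constant
  rows or constant columns, which do not affect cofactor sums.
\<close>

section \<open>Enumerating submatrices\<close>

text \<open>\<open>pick I a\<close> is the element of \<open>I\<close> with exactly \<open>a\<close>
  smaller ones, and for increasing \<open>f\<close> the elements below \<open>f a\<close> are the
  earlier values.\<close>

lemma pick_strict_mono_image:
  assumes f: "strict_mono_on {0..<m} f" and a: "a < m"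
  shows "pick (f ` {0..<m}) a = (f a :: nat)"
proof -
  have "{b \<in> f ` {0..<m}. b < f a} = f ` {0..<a}"
    using f a by (force simp: strict_mono_on_less)
  moreover have "inj_on f {0..<a}"
    using strict_mono_on_imp_inj_on[OF f] a by (rule_tac inj_on_subset) auto
  ultimately have "card {b \<in> f ` {0..<m}. b < f a} = a"
    by (simp add: card_image)
  with pick_card_in_set[of "f a" "f ` {0..<m}"] a show ?thesis by simp
qed

lemma strict_mono_on_pick: "strict_mono_on {0..<card I} (pick I)"
  using pick_mono_le by (auto simp: strict_mono_on_def)

lemma pick_image:
  assumes "finite I"
  shows "pick I ` {0..<card I} = I"
proof (rule card_subset_eq[OF assms])
  show "pick I ` {0..<card I} \<subseteq> I"
    using pick_in_set_le by auto
  show "card (pick I ` {0..<card I}) = card I"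
    using strict_mono_on_imp_inj_on[OF strict_mono_on_pick] by (simp add: card_image)
qed

text \<open>Frees computations from \<open>pick\<close>: initial segments, tails, sets with one
  element left out and swapped sets all have explicit increasing enumerations.\<close>

lemma submatrix_enum:
  assumes A: "A \<in> carrier_mat nr nc"
    and f: "strict_mono_on {0..<a} f" "f ` {0..<a} = I" "I \<subseteq> {0..<nr}"
    and g: "strict_mono_on {0..<b} g" "g ` {0..<b} = J" "J \<subseteq> {0..<nc}"
  shows "submatrix A I J = mat a b (\<lambda>(i, j). A $$ (f i, g j))"
proof -
  have sets: "{i. i < dim_row A \<and> i \<in> I} = I" "{j. j < dim_col A \<and> j \<in> J} = J"
    using A f g by auto
  have card: "card I = a" "card J = b"
    using card_image[OF strict_mono_on_imp_inj_on[OF f(1)]] f(2)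
      card_image[OF strict_mono_on_imp_inj_on[OF g(1)]] g(2) by auto
  have "pick I i = f i" if "i < a" for i
    using pick_strict_mono_image[OF f(1) that] f(2) by simp
  moreover have "pick J j = g j" if "j < b" for j
    using pick_strict_mono_image[OF g(1) that] g(2) by simp
  ultimately show ?thesis
    unfolding submatrix_def sets card by (intro cong_mat) auto
qed

lemma submatrix_finite:
  assumes "A \<in> carrier_mat nr nc" "I \<subseteq> {0..<nr}" "J \<subseteq> {0..<nc}"
  shows "submatrix A I J = mat (card I) (card J) (\<lambda>(i, j). A $$ (pick I i, pick J j))"
proof -
  have "finite I" "finite J"
    using assms finite_subset by blast+
  then show ?thesis
    using submatrix_enum assms strict_mono_on_pick pick_image by metis
qed

lemma pick_less:
  assumes "I \<subseteq> {0..<n}" "i < card I"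
  shows "pick I i < n"
  using pick_in_set_le[OF assms(2)] assms(1) by auto

section \<open>Rank-one updates and cofactor sums\<close>

text \<open>Column \<open>k\<close> is \<open>u\<close> itself, so each altered column arises by
  adding a multiple of column \<open>k\<close>, which preserves the determinant.\<close>

lemma det_addcol_outer:
  fixes B :: "'a :: comm_ring_1 mat"
  assumes "finite S" "k \<notin> S" "S \<subseteq> {..<n}" "k < n"
  shows "det (mat n n (\<lambda>(i, j). if j = k then u i
           else B $$ (i, j) + (if j \<in> S then u i * v j else 0))) =
         det (mat n n (\<lambda>(i, j). if j = k then u i else B $$ (i, j)))"
  using assms
proof (induction S rule: finite_induct)
  case empty
  show ?case by (intro arg_cong[of _ _ det] eq_matI) auto
next
  case (insert l S)
  let ?A = "mat n n (\<lambda>(i, j). if j = k then u i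
           else B $$ (i, j) + (if j \<in> S then u i * v j else 0))"
  have "mat n n (\<lambda>(i, j). if j = k then u i
           else B $$ (i, j) + (if j \<in> insert l S then u i * v j else 0)) = addcol (v l) l k ?A"
    using insert by (intro eq_matI) (auto simp: algebra_simps)
  moreover have "det (addcol (v l) l k ?A) = det ?A"
    using insert by (intro det_addcol) auto
  ultimately show ?case
    using insert by simp
qed

text \<open>Expansion along column \<open>k\<close>, whose cofactors do not involve that
  column.\<close>

lemma det_replace_column:
  fixes B :: "'a :: comm_ring_1 mat"
  assumes B: "B \<in> carrier_mat n n" and k: "k < n"
  shows "det (mat n n (\<lambda>(i, j). if j = k then u i else B $$ (i, j))) =
         (\<Sum>i<n. u i * cofactor B i k)"
proof -
  let ?A = "mat n n (\<lambda>(i, j). if j = k then u i else B $$ (i, j))"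
  have "det ?A = (\<Sum>i<n. ?A $$ (i, k) * cofactor ?A i k)"
    using k by (intro laplace_expansion_column) auto
  also have "\<dots> = (\<Sum>i<n. u i * cofactor B i k)"
  proof (intro sum.cong refl)
    fix i assume i: "i \<in> {..<n}"
    have "mat_delete ?A i k = mat_delete B i k"
      using B k i by (intro eq_matI) (auto simp: mat_delete_def)
    then show "?A $$ (i, k) * cofactor ?A i k = u i * cofactor B i k"
      using i k by (simp add: cofactor_def)
  qed
  finally show ?thesis .
qed

text \<open>Columns are updated one at a time and each new column is split by linearity. Once a
  column equals \<open>u\<close>, column operations undo the other updates, so only terms of first
  order in \<open>v\<close> survive.\<close>

lemma det_rank_one_update:
  fixes B :: "'a :: comm_ring_1 mat"
  assumes B: "B \<in> carrier_mat n n"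
  shows "det (mat n n (\<lambda>(i, j). B $$ (i, j) + u i * v j)) =
         det B + (\<Sum>j<n. \<Sum>i<n. u i * v j * cofactor B i j)"
proof -
  define D where "D S = mat n n (\<lambda>(i, j). B $$ (i, j) + (if j \<in> S then u i * v j else 0))" for S
  have D: "D S \<in> carrier_mat n n" for S by (simp add: D_def)
  have step: "det (D S) = det B + (\<Sum>j\<in>S. \<Sum>i<n. u i * v j * cofactor B i j)"
    if "finite S" "S \<subseteq> {..<n}" for S
    using that
  proof (induction S rule: finite_induct)
    case empty
    have "D {} = B" using B by (auto simp: D_def intro!: eq_matI)
    then show ?case by simp
  next
    case (insert k S)
    then have k: "k < n" by simp
    have col: "(\<Sum>i<n. w i * cofactor (D S) i k) =
        det (mat n n (\<lambda>(i, j). if j = k then w i else D S $$ (i, j)))" for w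
      using det_replace_column[OF D k] by simp
    have "D (insert k S) =
        mat n n (\<lambda>(i, j). if j = k then B $$ (i, k) + v k * u i else D S $$ (i, j))"
      by (auto simp: D_def algebra_simps intro!: eq_matI)
    then have "det (D (insert k S)) = (\<Sum>i<n. (B $$ (i, k) + v k * u i) * cofactor (D S) i k)"
      using col by simp
    also have "\<dots> = (\<Sum>i<n. B $$ (i, k) * cofactor (D S) i k)
                   + v k * (\<Sum>i<n. u i * cofactor (D S) i k)"
      by (simp add: algebra_simps sum.distrib sum_distrib_left)
    \<comment> \<open>As \<open>k\<close> is not in \<open>S\<close>, column \<open>k\<close> of
      \<open>D S\<close> is still that of \<open>B\<close>.\<close>
    also have "(\<Sum>i<n. B $$ (i, k) * cofactor (D S) i k) = det (D S)"
      unfolding col using insert by (intro arg_cong[of _ _ det] eq_matI) (auto simp: D_def)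
    also have "(\<Sum>i<n. u i * cofactor (D S) i k) =
        det (mat n n (\<lambda>(i, j). if j = k then u i
           else B $$ (i, j) + (if j \<in> S then u i * v j else 0)))"
      unfolding col by (intro arg_cong[of _ _ det] eq_matI) (auto simp: D_def)
    also have "\<dots> = (\<Sum>i<n. u i * cofactor B i k)"
      using insert k by (simp add: det_addcol_outer det_replace_column[OF B])
    finally show ?case
      using insert by (simp add: sum_distrib_left algebra_simps)
  qed
  have "D {..<n} = mat n n (\<lambda>(i, j). B $$ (i, j) + u i * v j)"
    by (auto simp: D_def intro!: eq_matI)
  with step[of "{..<n}"] show ?thesis by simp
qed

lemma cofsum_eq_sum_cofactor:
  assumes "B \<in> carrier_mat n n"
  shows "cofsum B = (\<Sum>j<n. \<Sum>i<n. cofactor B i j)"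
  using assms
  by (auto simp: cofsum_def ones_vec_def adj_mat_def scalar_prod_def lessThan_atLeast0
      intro!: sum.cong)

lemma det_add_const:
  assumes "B \<in> carrier_mat n n"
  shows "det (mat n n (\<lambda>(i, j). B $$ (i, j) + t)) = det B + t * cofsum B"
  using det_rank_one_update[OF assms, of "\<lambda>_. t" "\<lambda>_. 1"]
  by (simp add: cofsum_eq_sum_cofactor[OF assms] sum_distrib_left)

lemma cofsum_eq_det_diff:
  assumes "B \<in> carrier_mat n n"
  shows "cofsum B = det (mat n n (\<lambda>(i, j). B $$ (i, j) + 1)) - det B"
  using det_add_const[OF assms, of 1] by simp

text \<open>Adding 1 to every entry turns the vector \<open>x\<close> into \<open>x + 1\<close>, so
  the cofactor sum is a difference of two rank-one updates of the same \<open>B\<close>. The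
  correction term is linear in the vector, and \<open>x\<close> cancels.\<close>

lemma cofsum_add_row_const:
  assumes B: "B \<in> carrier_mat n n"
  shows "cofsum (mat n n (\<lambda>(i, j). B $$ (i, j) + x i)) = cofsum B"
proof -
  let ?C = "mat n n (\<lambda>(i, j). B $$ (i, j) + x i)"
  have "mat n n (\<lambda>(i, j). ?C $$ (i, j) + 1) = mat n n (\<lambda>(i, j). B $$ (i, j) + (x i + 1) * 1)"
    by (auto intro!: eq_matI)
  then have "cofsum ?C = det (mat n n (\<lambda>(i, j). B $$ (i, j) + (x i + 1) * 1))
      - det (mat n n (\<lambda>(i, j). B $$ (i, j) + x i * 1))"
    using cofsum_eq_det_diff[of ?C n] by simp
  also have "\<dots> = cofsum B"
    unfolding det_rank_one_update[OF B] cofsum_eq_sum_cofactor[OF B]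
    by (simp add: algebra_simps sum.distrib)
  finally show ?thesis .
qed

lemma cofsum_add_col_const:
  assumes B: "B \<in> carrier_mat n n"
  shows "cofsum (mat n n (\<lambda>(i, j). B $$ (i, j) + y j)) = cofsum B"
proof -
  let ?C = "mat n n (\<lambda>(i, j). B $$ (i, j) + y j)"
  have "mat n n (\<lambda>(i, j). ?C $$ (i, j) + 1) = mat n n (\<lambda>(i, j). B $$ (i, j) + 1 * (y j + 1))"
    by (auto intro!: eq_matI)
  then have "cofsum ?C = det (mat n n (\<lambda>(i, j). B $$ (i, j) + 1 * (y j + 1)))
      - det (mat n n (\<lambda>(i, j). B $$ (i, j) + 1 * y j))"
    using cofsum_eq_det_diff[of ?C n] by simp
  also have "\<dots> = cofsum B"
    unfolding det_rank_one_update[OF B] cofsum_eq_sum_cofactor[OF B]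
    by (simp add: algebra_simps sum.distrib)
  finally show ?thesis .
qed

lemma cofsum_smult:
  assumes B: "B \<in> carrier_mat n n" and n: "n > 0"
  shows "cofsum (c \<cdot>\<^sub>m B) = c ^ (n - 1) * cofsum B"
proof -
  have "cofactor (c \<cdot>\<^sub>m B) i j = c ^ (n - 1) * cofactor B i j" if "i < n" "j < n" for i j
  proof -
    have "mat_delete (c \<cdot>\<^sub>m B) i j = c \<cdot>\<^sub>m mat_delete B i j"
      using B that by (auto simp: mat_delete_def intro!: eq_matI)
    then show ?thesis
      using B by (simp add: cofactor_def)
  qed
  then show ?thesis
    using B by (simp add: cofsum_eq_sum_cofactor[of _ n] sum_distrib_left)
qed

section \<open>Jacobi's complementary minor identity\<close>

text \<open>An adjacent swap reverses the order of the pair \<open>i\<close>, \<open>Suc i\<close>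
  only.\<close>

lemma transpose_Suc_mono:
  assumes "i \<notin> S \<or> Suc i \<notin> S" "a \<in> S" "b \<in> S" "a < b"
  shows "Transposition.transpose i (Suc i) a < Transposition.transpose i (Suc i) b"
proof -
  have "\<not> (a = i \<and> b = Suc i)" using assms by auto
  then show ?thesis
    using assms by (auto simp: Transposition.transpose_def)
qed

text \<open>Without such a gap \<open>I\<close> would be closed downwards, hence an initial
  segment.\<close>

lemma exists_gap:
  assumes "finite I" "I \<noteq> {0..<card I}"
  obtains i where "Suc i \<in> I" "i \<notin> I"
proof -
  have "\<exists>i. Suc i \<in> I \<and> i \<notin> I"
  proof (rule ccontr)
    assume "\<nexists>i. Suc i \<in> I \<and> i \<notin> I"
    then have step: "\<And>i. Suc i \<in> I \<Longrightarrow> i \<in> I" by blast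
    have down: "j \<in> I" if "i \<in> I" "j \<le> i" for i j
      using that(2,1) by (induction j rule: inc_induct) (auto intro: step)
    have "I \<subseteq> {0..<card I}"
    proof
      fix i assume "i \<in> I"
      then have "{0..i} \<subseteq> I" using down by auto
      then have "card {0..i} \<le> card I" using assms(1) card_mono by blast
      then show "i \<in> {0..<card I}" by simp
    qed
    then show False
      using assms(2) card_subset_eq[of "{0..<card I}" I] by simp
  qed
  then show thesis using that by blast
qed

lemma sum_transpose_Suc:
  assumes "finite I" "Suc i \<in> I" "i \<notin> I"
  shows "\<Sum>I = Suc (\<Sum>(Transposition.transpose i (Suc i) ` I))"
proof -
  have "Transposition.transpose i (Suc i) ` I = insert i (I - {Suc i})"
    using assms by (auto simp: Transposition.transpose_def image_iff)
  then have "\<Sum>(Transposition.transpose i (Suc i) ` I) = i + \<Sum>(I - {Suc i})"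
    using assms by simp
  moreover have "\<Sum>I = Suc i + \<Sum>(I - {Suc i})"
    using assms by (simp add: sum.remove)
  ultimately show ?thesis by simp
qed

text \<open>The swap keeps the order on \<open>S\<close>, so permuting the matrix and the index set
  together selects the same entries in the same order. If \<open>Suc i\<close> lies in a set and
  \<open>i\<close> does not, the condition on \<open>S\<close> holds for the set and for its
  complement.\<close>

lemma submatrix_transpose_indices:
  assumes A: "A \<in> carrier_mat n n" and i: "Suc i < n" and S: "i \<notin> S \<or> Suc i \<notin> S"
    and SJ: "S \<subseteq> {0..<n}" "J \<subseteq> {0..<n}"
  defines "\<tau> \<equiv> Transposition.transpose i (Suc i)"
  shows "submatrix (mat n n (\<lambda>(a, b). A $$ (\<tau> a, b))) (\<tau> ` S) J = submatrix A S J"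
    and "submatrix (mat n n (\<lambda>(a, b). A $$ (a, \<tau> b))) J (\<tau> ` S) = submatrix A J S"
proof -
  have fin: "finite S" "finite J" using SJ finite_subset by blast+
  have enum: "strict_mono_on {0..<card S} (\<lambda>a. \<tau> (pick S a))"
    unfolding strict_mono_on_def \<tau>_def
    using transpose_Suc_mono[OF S] pick_in_set_le pick_mono_le by auto
  have im: "(\<lambda>a. \<tau> (pick S a)) ` {0..<card S} = \<tau> ` S"
    using pick_image[OF fin(1)] by (metis image_image)
  have sub: "\<tau> ` S \<subseteq> {0..<n}"
    using SJ i by (auto simp: \<tau>_def Transposition.transpose_def)
  have lt: "\<tau> (pick S a) < n" if "a < card S" for a
    using sub im that by (metis atLeastLessThan_iff imageI le0 subsetD)
  have inv: "\<tau> (\<tau> a) = a" for a by (simp add: \<tau>_def)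
  note J = strict_mono_on_pick pick_image[OF fin(2)] SJ(2)
  show "submatrix (mat n n (\<lambda>(a, b). A $$ (\<tau> a, b))) (\<tau> ` S) J = submatrix A S J"
    unfolding submatrix_finite[OF A SJ] submatrix_enum[OF mat_carrier enum im sub J]
    using lt SJ by (auto simp: inv pick_less)
  show "submatrix (mat n n (\<lambda>(a, b). A $$ (a, \<tau> b))) J (\<tau> ` S) = submatrix A J S"
    unfolding submatrix_finite[OF A SJ(2,1)] submatrix_enum[OF mat_carrier J enum im sub]
    using lt SJ by (auto simp: inv pick_less)
qed

text \<open>Let \<open>Q\<close> be the first \<open>k\<close> columns of \<open>N\<close> completed
  by unit columns. As \<open>M * N\<close> is the identity, \<open>P = M * Q\<close> consists of
  \<open>k\<close> unit columns followed by the last columns of \<open>M\<close>. Both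
  \<open>Q\<close> and \<open>P\<close> are block triangular, and their determinants are the two
  minors.\<close>

lemma jacobi_leading_minor:
  fixes M N :: "'a :: field mat"
  assumes M: "M \<in> carrier_mat n n" and N: "N \<in> carrier_mat n n" and MN: "M * N = 1\<^sub>m n"
    and k: "k \<le> n"
  shows "det (submatrix N {0..<k} {0..<k}) * det M =
         det (submatrix M ({0..<n} - {0..<k}) ({0..<n} - {0..<k}))"
proof -
  have c: "{0..<n} - {0..<k} = (\<lambda>i. k + i) ` {0..<n - k}"
  proof -
    have "k + i \<in> {0..<n} - {0..<k}" if "i < n - k" for i
      using that by auto
    moreover have "x \<in> (\<lambda>i. k + i) ` {0..<n - k}" if "x \<in> {0..<n} - {0..<k}" for x
      using that by (intro image_eqI[of _ _ "x - k"]) auto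
    ultimately show ?thesis by auto
  qed
  have Nk: "submatrix N {0..<k} {0..<k} = mat k k (\<lambda>(i, j). N $$ (i, j))"
    using k by (intro submatrix_enum[OF N]) (auto simp: strict_mono_on_def)
  have Mk: "submatrix M ({0..<n} - {0..<k}) ({0..<n} - {0..<k}) =
      mat (n - k) (n - k) (\<lambda>(i, j). M $$ (k + i, k + j))"
    unfolding c using k by (intro submatrix_enum[OF M]) (auto simp: strict_mono_on_def)
  define Q where "Q = mat n n (\<lambda>(i, j). if j < k then N $$ (i, j) else if i = j then 1 else 0)"
  define P where "P = mat n n (\<lambda>(i, j). if j < k then if i = j then 1 else 0 else M $$ (i, j))"
  have "Q = four_block_mat (mat k k (\<lambda>(i, j). N $$ (i, j))) (0\<^sub>m k (n - k))
              (mat (n - k) k (\<lambda>(i, j). N $$ (k + i, j))) (1\<^sub>m (n - k))"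
    using k by (auto simp: Q_def intro!: eq_matI)
  then have Q: "det Q = det (mat k k (\<lambda>(i, j). N $$ (i, j)))"
    by (simp add: det_four_block_mat_upper_right_zero[of _ k _ "n - k"])
  have "P = four_block_mat (1\<^sub>m k) (mat k (n - k) (\<lambda>(i, j). M $$ (i, k + j)))
              (0\<^sub>m (n - k) k) (mat (n - k) (n - k) (\<lambda>(i, j). M $$ (k + i, k + j)))"
    using k by (auto simp: P_def intro!: eq_matI)
  then have P: "det P = det (mat (n - k) (n - k) (\<lambda>(i, j). M $$ (k + i, k + j)))"
    by (simp add: det_four_block_mat_lower_left_zero[of _ k _ "n - k"])
  have "M * Q = P"
  proof (rule eq_matI)
    fix i j assume "i < dim_row P" "j < dim_col P"
    then have ij: "i < n" "j < n" by (auto simp: P_def)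
    have MQ: "(M * Q) $$ (i, j) = (\<Sum>l = 0..<n. M $$ (i, l) * Q $$ (l, j))"
      using M ij by (simp add: Q_def scalar_prod_def)
    have "(M * N) $$ (i, j) = (\<Sum>l = 0..<n. M $$ (i, l) * N $$ (l, j))"
      using M N ij by (simp add: scalar_prod_def)
    then have MN': "(\<Sum>l = 0..<n. M $$ (i, l) * N $$ (l, j)) = (if i = j then 1 else 0)"
      using ij by (simp add: MN)
    show "(M * Q) $$ (i, j) = P $$ (i, j)"
    proof (cases "j < k")
      case True
      then show ?thesis unfolding MQ using ij MN' by (simp add: Q_def P_def)
    next
      case False
      have "(M * Q) $$ (i, j) = (\<Sum>l = 0..<n. if l = j then M $$ (i, l) else 0)"
        unfolding MQ using ij False by (intro sum.cong) (auto simp: Q_def)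
      also have "\<dots> = P $$ (i, j)"
        using ij False by (simp add: P_def)
      finally show ?thesis .
    qed
  qed (use M in \<open>auto simp: P_def Q_def\<close>)
  then have "det M * det Q = det P"
    using det_mult[OF M, of Q] by (simp add: Q_def)
  then show ?thesis
    unfolding Nk Mk P Q by (simp add: mult.commute)
qed

text \<open>Adjacent transpositions move \<open>I\<close> and \<open>J\<close> to initial segments; each one changes the sign of
  \<open>det M\<close> and lowers \<open>\<Sum>I + \<Sum>J\<close> by one.\<close>

theorem jacobi_complementary_minor:
  fixes M N :: "'a :: field mat"
  assumes "M \<in> carrier_mat n n" "N \<in> carrier_mat n n" "M * N = 1\<^sub>m n"
    and "I \<subseteq> {0..<n}" "J \<subseteq> {0..<n}" "card I = card J"
  shows "det (submatrix N I J) * det M =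
         (- 1) ^ (\<Sum>I + \<Sum>J) * det (submatrix M ({0..<n} - J) ({0..<n} - I))"
  using assms
proof (induction "\<Sum>I + \<Sum>J" arbitrary: M N I J rule: less_induct)
  case less
  note M = less.prems(1) and N = less.prems(2) and MN = less.prems(3)
    and I = less.prems(4) and J = less.prems(5) and IJ = less.prems(6)
  have fin: "finite I" "finite J" using I J finite_subset by blast+
  have sum: "(\<Sum>l = 0..<n. M $$ (a, l) * N $$ (l, b)) = (if a = b then 1 else 0)"
    if "a < n" "b < n" for a b
  proof -
    have "(M * N) $$ (a, b) = (\<Sum>l = 0..<n. M $$ (a, l) * N $$ (l, b))"
      using M N that by (simp add: scalar_prod_def)
    then show ?thesis using that by (simp add: MN)
  qed
  consider "I = {0..<card I}" "J = {0..<card J}" | "I \<noteq> {0..<card I}" | "J \<noteq> {0..<card J}"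
    by blast
  then show ?case
  proof cases
    case 1
    have "card I \<le> n" using card_mono[OF _ I] by simp
    \<comment> \<open>Both sets are the same initial segment, so the sign is 1.\<close>
    moreover have "even (\<Sum>I + \<Sum>J)"
      using 1 IJ by (metis even_add)
    ultimately show ?thesis
      using jacobi_leading_minor[OF M N MN, of "card I"] 1 IJ by simp
  next
    case 2
    then obtain i where i: "Suc i \<in> I" "i \<notin> I"
      using exists_gap fin(1) by metis
    define \<tau> where "\<tau> = Transposition.transpose i (Suc i)"
    have n: "Suc i < n" using i I by auto
    have perm: "\<tau> permutes {0..<n}"
      unfolding \<tau>_def using n by (intro permutes_swap_id) auto
    \<comment> \<open>Permuting the rows of \<open>N\<close> together with the columns of
      \<open>M\<close> only reorders the summation index of the product.\<close>
    let ?M = "mat n n (\<lambda>(a, b). M $$ (a, \<tau> b))" and ?N = "mat n n (\<lambda>(a, b). N $$ (\<tau> a, b))"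
    have MN': "?M * ?N = 1\<^sub>m n"
    proof (rule eq_matI)
      fix a b assume "a < dim_row (1\<^sub>m n :: 'a mat)" "b < dim_col (1\<^sub>m n :: 'a mat)"
      then have ab: "a < n" "b < n" by auto
      then have "(?M * ?N) $$ (a, b) = (\<Sum>l = 0..<n. M $$ (a, \<tau> l) * N $$ (\<tau> l, b))"
        by (simp add: scalar_prod_def)
      also have "\<dots> = (\<Sum>l = 0..<n. M $$ (a, l) * N $$ (l, b))"
        using sum.permute[OF perm, of "\<lambda>l. M $$ (a, l) * N $$ (l, b)"] by (simp add: comp_def)
      finally show "(?M * ?N) $$ (a, b) = 1\<^sub>m n $$ (a, b)"
        using sum ab by simp
    qed auto
    have I': "\<tau> ` I \<subseteq> {0..<n}"
      using I perm permutes_image by blast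
    have comp: "{0..<n} - \<tau> ` I = \<tau> ` ({0..<n} - I)"
      using permutes_image[OF perm] permutes_inj[OF perm] by (metis image_set_diff)
    have "det ?M = - det M"
    proof -
      have "?M = swapcols i (Suc i) M"
        using M n by (auto simp: \<tau>_def Transposition.transpose_def intro!: eq_matI)
      then show ?thesis using M n by (simp add: det_swapcols[of _ n])
    qed
    moreover have "submatrix ?N (\<tau> ` I) J = submatrix N I J"
      unfolding \<tau>_def using i by (intro submatrix_transpose_indices(1)[OF N n _ I J]) auto
    moreover have "submatrix ?M ({0..<n} - J) (\<tau> ` ({0..<n} - I)) =
        submatrix M ({0..<n} - J) ({0..<n} - I)"
      unfolding \<tau>_def using i by (intro submatrix_transpose_indices(2)[OF M n]) auto
    moreover have s: "\<Sum>I = Suc (\<Sum>(\<tau> ` I))"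
      unfolding \<tau>_def using sum_transpose_Suc fin(1) i by blast
    moreover have "card (\<tau> ` I) = card J"
      using IJ permutes_inj[OF perm] by (metis card_image inj_on_subset subset_UNIV)
    ultimately have "- (det (submatrix N I J) * det M) =
        (- 1) ^ (\<Sum>(\<tau> ` I) + \<Sum>J) * det (submatrix M ({0..<n} - J) ({0..<n} - I))"
      using less.hyps[OF _ _ _ MN' I' J] by (simp add: comp)
    from arg_cong[OF this, of uminus] show ?thesis
      by (simp add: s)
  next
    case 3
    then obtain i where i: "Suc i \<in> J" "i \<notin> J"
      using exists_gap fin(2) by metis
    define \<tau> where "\<tau> = Transposition.transpose i (Suc i)"
    have inv: "\<tau> (\<tau> a) = a" for a by (simp add: \<tau>_def)
    have n: "Suc i < n" using i J by auto
    have perm: "\<tau> permutes {0..<n}"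
      unfolding \<tau>_def using n by (intro permutes_swap_id) auto
    \<comment> \<open>Permuting the columns of \<open>N\<close> and the rows of \<open>M\<close>
      conjugates the product by \<open>\<tau>\<close>, which fixes the identity matrix.\<close>
    let ?M = "mat n n (\<lambda>(a, b). M $$ (\<tau> a, b))" and ?N = "mat n n (\<lambda>(a, b). N $$ (a, \<tau> b))"
    have MN': "?M * ?N = 1\<^sub>m n"
    proof (rule eq_matI)
      fix a b assume "a < dim_row (1\<^sub>m n :: 'a mat)" "b < dim_col (1\<^sub>m n :: 'a mat)"
      then have ab: "a < n" "b < n" by auto
      then have "(?M * ?N) $$ (a, b) = (\<Sum>l = 0..<n. M $$ (\<tau> a, l) * N $$ (l, \<tau> b))"
        by (simp add: scalar_prod_def)
      moreover have "\<tau> a < n" "\<tau> b < n" "\<tau> a = \<tau> b \<longleftrightarrow> a = b"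
        using ab permutes_in_image[OF perm] inv by (auto, metis)
      ultimately show "(?M * ?N) $$ (a, b) = 1\<^sub>m n $$ (a, b)"
        using sum ab by simp
    qed auto
    have J': "\<tau> ` J \<subseteq> {0..<n}"
      using J perm permutes_image by blast
    have comp: "{0..<n} - \<tau> ` J = \<tau> ` ({0..<n} - J)"
      using permutes_image[OF perm] permutes_inj[OF perm] by (metis image_set_diff)
    have "det ?M = - det M"
    proof -
      have "?M = swaprows i (Suc i) M"
        using M n by (auto simp: \<tau>_def Transposition.transpose_def intro!: eq_matI)
      then show ?thesis using M n by (simp add: det_swaprows[of _ n])
    qed
    moreover have "submatrix ?N I (\<tau> ` J) = submatrix N I J"
      unfolding \<tau>_def using i by (intro submatrix_transpose_indices(2)[OF N n _ J I]) auto
    moreover have "submatrix ?M (\<tau> ` ({0..<n} - J)) ({0..<n} - I) =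
        submatrix M ({0..<n} - J) ({0..<n} - I)"
      unfolding \<tau>_def using i by (intro submatrix_transpose_indices(1)[OF M n]) auto
    moreover have s: "\<Sum>J = Suc (\<Sum>(\<tau> ` J))"
      unfolding \<tau>_def using sum_transpose_Suc fin(2) i by blast
    moreover have "card I = card (\<tau> ` J)"
      using IJ permutes_inj[OF perm] by (metis card_image inj_on_subset subset_UNIV)
    ultimately have "- (det (submatrix N I J) * det M) =
        (- 1) ^ (\<Sum>I + \<Sum>(\<tau> ` J)) * det (submatrix M ({0..<n} - J) ({0..<n} - I))"
      using less.hyps[OF _ _ _ MN' I J'] by (simp add: comp)
    from arg_cong[OF this, of uminus] show ?thesis
      by (simp add: s)
  qed
qed

section \<open>The matrix-tree theorem\<close>

text \<open>Multilinearity in the rows: in each Leibniz term the product of row sums is distributed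
  over the choices of one summand per row.\<close>

lemma det_sum_rows:
  fixes g :: "nat \<Rightarrow> 'b \<Rightarrow> nat \<Rightarrow> 'a :: comm_ring_1"
  assumes "\<And>i. i < n \<Longrightarrow> finite (S i)"
  shows "det (mat n n (\<lambda>(i, j). \<Sum>w\<in>S i. g i w j)) =
         (\<Sum>f\<in>Pi\<^sub>E {0..<n} S. det (mat n n (\<lambda>(i, j). g i (f i) j)))"
proof -
  let ?P = "{p. p permutes {0..<n}}"
  have prod: "(\<Prod>i = 0..<n. mat n n h $$ (i, p i)) = (\<Prod>i = 0..<n. h (i, p i))"
    if "p \<in> ?P" for p and h :: "nat \<times> nat \<Rightarrow> 'a"
    using that permutes_in_image[of p "{0..<n}"] by (intro prod.cong) auto
  have "det (mat n n (\<lambda>(i, j). \<Sum>w\<in>S i. g i w j)) =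
      (\<Sum>p\<in>?P. signof p * (\<Prod>i = 0..<n. \<Sum>w\<in>S i. g i w (p i)))"
    by (subst det_def'[of _ n]) (auto simp: prod intro!: sum.cong)
  also have "\<dots> = (\<Sum>p\<in>?P. signof p * (\<Sum>f\<in>Pi\<^sub>E {0..<n} S. \<Prod>i = 0..<n. g i (f i) (p i)))"
    using assms by (subst prod_sum_PiE) auto
  also have "\<dots> = (\<Sum>f\<in>Pi\<^sub>E {0..<n} S. \<Sum>p\<in>?P. signof p * (\<Prod>i = 0..<n. g i (f i) (p i)))"
    unfolding sum_distrib_left by (rule sum.swap)
  also have "\<dots> = (\<Sum>f\<in>Pi\<^sub>E {0..<n} S. det (mat n n (\<lambda>(i, j). g i (f i) j)))"
    by (intro sum.cong refl, subst det_def'[of _ n]) (auto simp: prod intro!: sum.cong)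
  finally show ?thesis .
qed

section \<open>Determinants of functional graphs\<close>

text \<open>A height that each step of \<open>f\<close> lowers by one until \<open>r\<close> is met.
  The value is meaningful only when the orbit of \<open>v\<close> meets \<open>r\<close>.\<close>

definition depth :: "(nat \<Rightarrow> nat) \<Rightarrow> nat \<Rightarrow> nat \<Rightarrow> nat" where
  "depth f r v = (LEAST k. (f ^^ k) v = r)"

lemma depth_step:
  assumes "\<exists>k. (f ^^ k) v = r" and "v \<noteq> r"
  shows "depth f r v = Suc (depth f r (f v))"
proof -
  obtain k where "(f ^^ k) v = r" using assms by blast
  then have "depth f r v = Suc (LEAST m. (f ^^ Suc m) v = r)"
    unfolding depth_def using assms(2) by (intro Least_Suc) auto
  then show ?thesis
    by (simp add: depth_def funpow_Suc_right del: funpow.simps)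
qed

text \<open>The Laplacian of the graph with arcs from \<open>i\<close> to \<open>f i\<close> for
  \<open>i \<noteq> r\<close>, with row \<open>r\<close> replaced by a unit row. For
  \<open>r < n\<close> its determinant is thus the principal minor that omits
  \<open>r\<close>.\<close>

definition functional_matrix :: "nat \<Rightarrow> nat \<Rightarrow> (nat \<Rightarrow> nat) \<Rightarrow> real mat" where
  "functional_matrix n r f =
     mat n n (\<lambda>(i, j). of_bool (i = j) - of_bool (i \<noteq> r \<and> f i = j))"

text \<open>A permutation that contributes to the Leibniz expansion fixes a vertex or moves it one step
  towards the root; as it preserves the total depth, it is the identity.\<close>

lemma det_functional_matrix_reaching:
  assumes reach: "\<And>v. v < n \<Longrightarrow> \<exists>k. (f ^^ k) v = r"
  shows "det (functional_matrix n r f) = 1"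
proof -
  let ?A = "functional_matrix n r f" and ?d = "depth f r"
  have entry: "?A $$ (i, j) = of_bool (i = j) - of_bool (i \<noteq> r \<and> f i = j)"
    if "i < n" "j < n" for i j
    using that by (simp add: functional_matrix_def)
  have zero: "(\<Prod>i = 0..<n. ?A $$ (i, p i)) = 0" if p: "p permutes {0..<n}" and "p \<noteq> id" for p
  proof (rule ccontr)
    assume "(\<Prod>i = 0..<n. ?A $$ (i, p i)) \<noteq> 0"
    then have nz: "?A $$ (i, p i) \<noteq> 0" if "i < n" for i
      using that by (simp add: prod_zero_iff)
    have moves: "p i = i \<or> ?d (p i) < ?d i" if "i < n" for i
    proof -
      have "p i < n" using permutes_in_image[OF p, of i] that by simp
      with nz[OF that] entry[OF that] have "p i = i \<or> (i \<noteq> r \<and> f i = p i)"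
        by (auto split: if_splits)
      then show ?thesis
        using depth_step[OF reach[OF that]] by auto
    qed
    have "p i = i" for i
    proof (cases "i < n")
      case True
      show ?thesis
      proof (rule ccontr)
        assume "p i \<noteq> i"
        have "(\<Sum>i = 0..<n. ?d (p i)) < (\<Sum>i = 0..<n. ?d i)"
        proof (rule sum_strict_mono_ex1)
          show "\<forall>i\<in>{0..<n}. ?d (p i) \<le> ?d i" using moves by force
          show "\<exists>i\<in>{0..<n}. ?d (p i) < ?d i" using moves True \<open>p i \<noteq> i\<close> by force
        qed simp
        then show False
          using sum.permute[OF p, of ?d] by (simp add: comp_def)
      qed
    next
      case False
      then show ?thesis using p by (simp add: permutes_def)
    qed
    with \<open>p \<noteq> id\<close> show False by auto
  qed
  have "det ?A = (\<Sum>p\<in>{p. p permutes {0..<n}}. signof p * (\<Prod>i = 0..<n. ?A $$ (i, p i)))"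
    by (rule det_def') (simp add: functional_matrix_def)
  also have "\<dots> = (\<Sum>p\<in>{id}. signof p * (\<Prod>i = 0..<n. ?A $$ (i, p i)))"
    using zero by (intro sum.mono_neutral_right) (auto simp: permutes_id finite_permutations)
  also have "\<dots> = (\<Prod>i = 0..<n. ?A $$ (i, i))" by simp
  \<comment> \<open>A vertex other than the root is not fixed by \<open>f\<close>, since its depth
    drops; so no diagonal entry is cancelled.\<close>
  also have "\<dots> = 1"
  proof (intro prod.neutral ballI)
    fix i assume "i \<in> {0..<n}"
    then show "?A $$ (i, i) = 1"
      using depth_step[OF reach, of i] entry[of i i] by (cases "i = r") auto
  qed
  finally show ?thesis .
qed

text \<open>The indicator of the vertices that never reach the root lies in the kernel.\<close>

lemma det_functional_matrix_not_reaching: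
  assumes f: "\<And>v. v < n \<Longrightarrow> f v < n" and v: "v < n" "\<nexists>k. (f ^^ k) v = r"
  shows "det (functional_matrix n r f) = 0"
proof -
  define x where "x = vec n (\<lambda>u. of_bool (\<nexists>k. (f ^^ k) u = r) :: real)"
  have "x \<noteq> 0\<^sub>v n"
  proof
    assume "x = 0\<^sub>v n"
    then have "x $ v = 0" using v by simp
    with v show False by (simp add: x_def)
  qed
  moreover have "functional_matrix n r f *\<^sub>v x = 0\<^sub>v n"
  proof (rule eq_vecI)
    fix i assume "i < dim_vec (0\<^sub>v n :: real vec)"
    then have i: "i < n" by simp
    have "(functional_matrix n r f *\<^sub>v x) $ i =
        (\<Sum>j = 0..<n. (of_bool (i = j) - of_bool (i \<noteq> r \<and> f i = j)) * x $ j)"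
      using i by (simp add: functional_matrix_def x_def scalar_prod_def)
    also have "\<dots> = (\<Sum>j = 0..<n. (if j = i then x $ j else 0))
        - (\<Sum>j = 0..<n. (if j = f i then of_bool (i \<noteq> r) * x $ j else 0))"
      unfolding sum_subtractf[symmetric] by (intro sum.cong) auto
    also have "\<dots> = x $ i - of_bool (i \<noteq> r) * x $ f i"
      using i f[OF i] by simp
    \<comment> \<open>The root reaches itself in zero steps, so \<open>x\<close> vanishes there. Any
      other vertex reaches the root exactly when its image does, so \<open>x\<close> agrees at
      \<open>i\<close> and \<open>f i\<close>.\<close>
    also have "\<dots> = 0"
    proof (cases "i = r")
      case True
      then have "\<exists>k. (f ^^ k) i = r" by (metis funpow_0)
      then show ?thesis using i True by (auto simp: x_def)
    next
      case False
      have "(\<exists>k. (f ^^ k) i = r) \<longleftrightarrow> (\<exists>k. (f ^^ k) (f i) = r)"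
      proof
        assume "\<exists>k. (f ^^ k) i = r"
        then obtain k where k: "(f ^^ k) i = r" by blast
        with False obtain m where "k = Suc m" by (cases k) auto
        with k show "\<exists>k. (f ^^ k) (f i) = r"
          by (auto simp: funpow_Suc_right simp del: funpow.simps)
      next
        assume "\<exists>k. (f ^^ k) (f i) = r"
        then show "\<exists>k. (f ^^ k) i = r"
          by (metis funpow_Suc_right comp_apply)
      qed
      then show ?thesis using i f[OF i] False by (auto simp: x_def)
    qed
    finally show "(functional_matrix n r f *\<^sub>v x) $ i = 0\<^sub>v n $ i" using i by simp
  qed (simp add: functional_matrix_def)
  moreover have "x \<in> carrier_vec n" by (simp add: x_def)
  ultimately show ?thesis
    by (subst det_0_iff_vec_prod_zero_field[of _ n]) (auto simp: functional_matrix_def)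
qed

lemma submatrix_delete_one:
  assumes A: "A \<in> carrier_mat n n" and r: "r < n"
  shows "submatrix A ({0..<n} - {r}) ({0..<n} - {r}) = mat_delete A r r"
proof -
  let ?f = "\<lambda>i. if i < r then i else Suc i"
  have "strict_mono_on {0..<n - 1} ?f" by (auto simp: strict_mono_on_def)
  moreover have "?f ` {0..<n - 1} = {0..<n} - {r}"
  proof (intro equalityI subsetI)
    fix x assume x: "x \<in> {0..<n} - {r}"
    then have "x = ?f (if x < r then x else x - 1)" by auto
    moreover have "(if x < r then x else x - 1) \<in> {0..<n - 1}" using x r by auto
    ultimately show "x \<in> ?f ` {0..<n - 1}" by blast
  qed (use r in auto)
  ultimately have "submatrix A ({0..<n} - {r}) ({0..<n} - {r}) =
      mat (n - 1) (n - 1) (\<lambda>(i, j). A $$ (?f i, ?f j))"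
    by (intro submatrix_enum[OF A]) auto
  then show ?thesis using A by (simp add: mat_delete_def)
qed

text \<open>Row \<open>r\<close> is replaced by a unit row and the root gets the single dummy choice
  \<open>r\<close>. Expansion along this row gives back the minor of \<open>L\<close>, while
  expansion over all choices gives a \<open>functional_matrix\<close> for each choice
  function.\<close>

lemma det_principal_minor_eq_card:
  fixes S :: "nat \<Rightarrow> nat set"
  assumes S: "\<And>i. i < n \<Longrightarrow> S i \<subseteq> {0..<n}" and r: "r < n"
    and L: "L = mat n n (\<lambda>(i, j). \<Sum>w\<in>S i. of_bool (i = j) - of_bool (w = j) :: real)"
  shows "det (submatrix L ({0..<n} - {r}) ({0..<n} - {r})) =
         real (card {f \<in> Pi\<^sub>E {0..<n} (S(r := {r})). \<forall>v<n. \<exists>k. (f ^^ k) v = r})"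
proof -
  let ?S = "S(r := {r})"
  have S': "i < n \<Longrightarrow> ?S i \<subseteq> {0..<n}" for i using S r by auto
  then have fin: "i < n \<Longrightarrow> finite (?S i)" for i
    using finite_subset by blast
  define L' where
    "L' = mat n n (\<lambda>(i, j). \<Sum>w\<in>?S i. of_bool (i = j) - of_bool (i \<noteq> r \<and> w = j) :: real)"
  have L': "L' \<in> carrier_mat n n" by (simp add: L'_def)
  have "det L' = (\<Sum>j<n. L' $$ (r, j) * cofactor L' r j)"
    by (rule laplace_expansion_row[OF L' r])
  also have "\<dots> = (\<Sum>j<n. if j = r then cofactor L' r j else 0)"
    using r by (intro sum.cong) (auto simp: L'_def)
  also have "\<dots> = det (mat_delete L' r r)"
    using r by (simp add: cofactor_def)
  also have "mat_delete L' r r = mat_delete L r r"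
    unfolding L L'_def mat_delete_def by (intro cong_mat) (auto simp: less_diff_conv)
  also have "\<dots> = submatrix L ({0..<n} - {r}) ({0..<n} - {r})"
    using submatrix_delete_one[OF _ r, of L] by (simp add: L)
  finally have "det (submatrix L ({0..<n} - {r}) ({0..<n} - {r})) = det L'" by simp
  also have "\<dots> = (\<Sum>f\<in>Pi\<^sub>E {0..<n} ?S. det (functional_matrix n r f))"
    unfolding L'_def functional_matrix_def using fin by (rule det_sum_rows)
  also have "\<dots> = (\<Sum>f\<in>Pi\<^sub>E {0..<n} ?S. of_bool (\<forall>v<n. \<exists>k. (f ^^ k) v = r))"
  proof (intro sum.cong refl)
    fix f assume f: "f \<in> Pi\<^sub>E {0..<n} ?S"
    show "det (functional_matrix n r f) = of_bool (\<forall>v<n. \<exists>k. (f ^^ k) v = r)"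
    proof (cases "\<forall>v<n. \<exists>k. (f ^^ k) v = r")
      case True
      then show ?thesis using det_functional_matrix_reaching[of n f r] by simp
    next
      case False
      moreover have "f v < n" if "v < n" for v
      proof -
        have "f v \<in> ?S v" using f that by (auto simp: PiE_def Pi_def)
        then show ?thesis using S'[OF that] by auto
      qed
      ultimately show ?thesis
        using det_functional_matrix_not_reaching[of n f _ r] by fastforce
    qed
  qed
  also have "\<dots> = real (card {f \<in> Pi\<^sub>E {0..<n} ?S. \<forall>v<n. \<exists>k. (f ^^ k) v = r})"
  proof -
    have "finite (Pi\<^sub>E {0..<n} ?S)" using fin by (intro finite_PiE) auto
    then show ?thesis by (simp add: sum.If_cases of_bool_def Int_def)
  qed
  finally show ?thesis .
qed

section \<open>Oriented spanning trees as functions\<close>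

definition tree_of :: "nat \<Rightarrow> nat \<Rightarrow> (nat \<Rightarrow> nat) \<Rightarrow> nat pair_pre_digraph" where
  "tree_of n r f = \<lparr>pverts = {1..n}, parcs = {(Suc v, Suc (f v)) | v. v < n \<and> v \<noteq> r}\<rparr>"

definition succs :: "nat pair_pre_digraph \<Rightarrow> nat \<Rightarrow> nat set" where
  "succs G i = {j. (Suc i, Suc j) \<in> parcs G}"

lemma wf_digraph_with_proj_iff:
  "wf_digraph (with_proj T) \<longleftrightarrow> parcs T \<subseteq> pverts T \<times> pverts T"
  unfolding wf_digraph_def by (auto simp: with_proj_def)

text \<open>Segments of an orbit are walks, so a repeated point yields a closed walk.\<close>

lemma pcas_orbit:
  "k \<le> l \<Longrightarrow> pcas (Suc ((f ^^ k) v)) (map (\<lambda>i. (Suc ((f ^^ i) v), Suc ((f ^^ Suc i) v))) [k..<l])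
     (Suc ((f ^^ l) v))"
proof (induction k rule: inc_induct)
  case (step k)
  then show ?case by (simp add: upt_conv_Cons del: funpow.simps)
qed simp

text \<open>Each arc lowers the depth by one. With \<open>u = w\<close> this forces \<open>p\<close>
  to be empty, which is acyclicity.\<close>

lemma pcas_tree_of_depth:
  assumes reach: "\<And>v. v < n \<Longrightarrow> \<exists>k. (f ^^ k) v = r"
    and "pcas u p w" "set p \<subseteq> parcs (tree_of n r f)"
  shows "depth f r (u - 1) = depth f r (w - 1) + length p"
  using assms(2,3)
proof (induction p arbitrary: u)
  case (Cons e p)
  then obtain v where v: "v < n" "v \<noteq> r" "e = (Suc v, Suc (f v))"
    by (auto simp: tree_of_def)
  have "depth f r (Suc (f v) - 1) = depth f r (w - 1) + length p"
    using Cons.prems v by (intro Cons.IH) auto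
  moreover have "u = Suc v" using Cons.prems v by simp
  ultimately show ?case
    using depth_step[OF reach] v by simp
qed simp

text \<open>Cycles may be traded for arbitrary closed walks, because every nonempty closed walk
  contains a cycle.\<close>

lemma oriented_spanning_tree_iff:
  assumes wf: "pair_wf_digraph G"
  shows "oriented_spanning_tree G r T \<longleftrightarrow>
    pverts T = pverts G \<and> parcs T \<subseteq> parcs G \<and>
    (\<forall>u p. u \<in> pverts G \<longrightarrow> set p \<subseteq> parcs T \<longrightarrow> pcas u p u \<longrightarrow> p = []) \<and>
    card {e \<in> parcs T. fst e = r} = 0 \<and>
    (\<forall>v\<in>pverts G - {r}. card {e \<in> parcs T. fst e = v} = 1)"
proof -
  have G: "parcs G \<subseteq> pverts G \<times> pverts G"
    using pair_wf_digraph.arc_fst_in_verts[OF wf] pair_wf_digraph.arc_snd_in_verts[OF wf]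
    by force
  have span: "spanning T G \<longleftrightarrow> pverts T = pverts G \<and> parcs T \<subseteq> parcs G"
    using G by (auto simp: spanning_def subgraph_def wf_digraph_with_proj_iff compatible_def)
  have deg: "out_degree (with_proj T) v = card {e \<in> parcs T. fst e = v}" for v
    by (simp add: out_degree_def out_arcs_def)
  have cyc: "(\<nexists>p. pre_digraph.cycle (with_proj T) p) \<longleftrightarrow>
      (\<forall>u p. u \<in> pverts G \<longrightarrow> set p \<subseteq> parcs T \<longrightarrow> pcas u p u \<longrightarrow> p = [])"
    if "pverts T = pverts G" "parcs T \<subseteq> parcs G"
  proof -
    have wT: "wf_digraph (with_proj T)"
      using G that by (auto simp: wf_digraph_with_proj_iff)
    have "(\<exists>p. pre_digraph.cycle (with_proj T) p) \<longleftrightarrow>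
        (\<exists>p. wf_digraph.closed_w (with_proj T) p)"
      using wf_digraph.closed_w_imp_cycle[OF wT]
      by (auto simp: pre_digraph.cycle_def wf_digraph.closed_w_def[OF wT])
    then show ?thesis
      by (auto simp: wf_digraph.closed_w_def[OF wT] pre_digraph.awalk_def cas_with_proj_eq that)
  qed
  show ?thesis
    unfolding oriented_spanning_tree_def span deg using cyc by auto
qed

text \<open>Given one outgoing arc at each vertex but the root, acyclicity means that every orbit
  meets the root: depth excludes closed walks, and an orbit avoiding the root must revisit a
  vertex.\<close>

lemma tree_of_bij_betw:
  assumes G: "pair_wf_digraph G" and V: "pverts G = {1..n}" and r: "r < n"
  shows "bij_betw (tree_of n r)
    {f \<in> Pi\<^sub>E {0..<n} ((succs G)(r := {r})). \<forall>v<n. \<exists>k. (f ^^ k) v = r}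
    {T. oriented_spanning_tree G (Suc r) T}"
    (is "bij_betw _ ?F ?T")
proof (rule bij_betw_imageI)
  let ?S = "(succs G)(r := {r})"
  show "inj_on (tree_of n r) ?F"
  proof (rule inj_onI)
    fix f g assume f: "f \<in> ?F" and g: "g \<in> ?F" and eq: "tree_of n r f = tree_of n r g"
    have "f v = g v" if "v \<in> {0..<n}" for v
    proof (cases "v = r")
      case True
      have "f v \<in> ?S v" "g v \<in> ?S v" using f g that by (auto simp: PiE_def Pi_def)
      then show ?thesis using True by simp
    next
      case False
      then have "(Suc v, Suc (f v)) \<in> parcs (tree_of n r f)"
        using that by (auto simp: tree_of_def)
      then show ?thesis unfolding eq by (auto simp: tree_of_def)
    qed
    moreover have "f \<in> Pi\<^sub>E {0..<n} ?S" "g \<in> Pi\<^sub>E {0..<n} ?S" using f g by auto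
    ultimately show "f = g" by (metis PiE_ext)
  qed
  show "tree_of n r ` ?F = ?T"
  proof (intro equalityI subsetI)
    fix T assume "T \<in> tree_of n r ` ?F"
    then obtain f where f: "f \<in> Pi\<^sub>E {0..<n} ?S" and reach: "\<And>v. v < n \<Longrightarrow> \<exists>k. (f ^^ k) v = r"
      and T: "T = tree_of n r f" by auto
    have "parcs T \<subseteq> parcs G"
    proof
      fix e assume "e \<in> parcs T"
      then obtain v where v: "v < n" "v \<noteq> r" "e = (Suc v, Suc (f v))"
        by (auto simp: T tree_of_def)
      then have "f v \<in> ?S v" using f by (auto simp: PiE_def Pi_def)
      with v show "e \<in> parcs G" by (simp add: succs_def)
    qed
    moreover have "p = []" if "set p \<subseteq> parcs T" "pcas u p u" for u p
      using pcas_tree_of_depth[OF reach that(2)] that(1) by (simp add: T)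
    moreover have "{e \<in> parcs T. fst e = Suc r} = {}"
      by (auto simp: T tree_of_def)
    then have "card {e \<in> parcs T. fst e = Suc r} = 0"
      by (metis card.empty)
    moreover have "pverts T = pverts G" by (simp add: T tree_of_def V)
    moreover have "card {e \<in> parcs T. fst e = v} = 1" if "v \<in> pverts G - {Suc r}" for v
    proof -
      have "{e \<in> parcs T. fst e = v} = {(v, Suc (f (v - 1)))}"
        using that V by (auto simp: T tree_of_def intro!: exI[of _ "v - 1"])
      then show ?thesis by simp
    qed
    ultimately show "T \<in> ?T"
      unfolding mem_Collect_eq oriented_spanning_tree_iff[OF G] by blast
  next
    fix T assume "T \<in> ?T"
    then have VT: "pverts T = pverts G" and ET: "parcs T \<subseteq> parcs G"
      and acyc: "\<And>u p. u \<in> pverts G \<Longrightarrow> set p \<subseteq> parcs T \<Longrightarrow> pcas u p u \<Longrightarrow> p = []"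
      and root: "card {e \<in> parcs T. fst e = Suc r} = 0"
      and out: "\<And>v. v \<in> pverts G - {Suc r} \<Longrightarrow> card {e \<in> parcs T. fst e = v} = 1"
      by (auto simp: oriented_spanning_tree_iff[OF G])
    have wf: "fst e \<in> {1..n}" "snd e \<in> {1..n}" if "e \<in> parcs T" for e
      using pair_wf_digraph.arc_fst_in_verts[OF G, of e] pair_wf_digraph.arc_snd_in_verts[OF G, of e]
        that ET V by auto
    have "parcs T \<subseteq> {1..n} \<times> {1..n}" using wf by force
    \<comment> \<open>Infinite sets also have \<open>card\<close> 0, so finiteness is established
      before the root condition is read as the absence of outgoing arcs.\<close>
    then have "finite (parcs T)" by (rule finite_subset) simp
    then have root': "fst e \<noteq> Suc r" if "e \<in> parcs T" for e
      using root that by (cases e) auto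
    have "\<exists>w. {e \<in> parcs T. fst e = Suc v} = {(Suc v, Suc w)}" if "v < n" "v \<noteq> r" for v
    proof -
      have "card {e \<in> parcs T. fst e = Suc v} = 1"
        using that V by (intro out) auto
      then obtain e where e: "{e \<in> parcs T. fst e = Suc v} = {e}"
        by (rule card_1_singletonE)
      then have "e \<in> parcs T" "fst e = Suc v" by auto
      with wf[of e] have "e = (Suc v, Suc (snd e - 1))" by (cases e) auto
      with e show ?thesis by metis
    qed
    then obtain h where h:
      "\<And>v. v < n \<Longrightarrow> v \<noteq> r \<Longrightarrow> {e \<in> parcs T. fst e = Suc v} = {(Suc v, Suc (h v))}"
      by metis
    \<comment> \<open>The root receives its dummy value, and \<open>restrict\<close> makes
      \<open>f\<close> undefined outside the index range, as membership in \<open>Pi\<^sub>E\<close>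
      demands.\<close>
    define f where "f = restrict (h(r := r)) {0..<n}"
    have arcs: "parcs T = {(Suc v, Suc (f v)) | v. v < n \<and> v \<noteq> r}"
    proof (intro equalityI subsetI)
      fix e assume e: "e \<in> parcs T"
      define v where "v = fst e - 1"
      have v: "v < n" "v \<noteq> r" "fst e = Suc v"
        using wf[OF e] root'[OF e] by (auto simp: v_def)
      then have "e = (Suc v, Suc (f v))" using h[of v] e by (auto simp: f_def)
      with v show "e \<in> {(Suc v, Suc (f v)) | v. v < n \<and> v \<noteq> r}" by blast
    next
      fix e assume "e \<in> {(Suc v, Suc (f v)) | v. v < n \<and> v \<noteq> r}"
      then obtain v where v: "v < n" "v \<noteq> r" "e = (Suc v, Suc (f v))" by blast
      then show "e \<in> parcs T" using h[of v] by (auto simp: f_def)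
    qed
    have T: "T = tree_of n r f"
      by (rule pair_pre_digraph.equality) (simp_all add: tree_of_def VT V arcs)
    have fS: "f \<in> Pi\<^sub>E {0..<n} ?S"
    proof (rule PiE_I)
      fix v assume v: "v \<in> {0..<n}"
      show "f v \<in> ?S v"
      proof (cases "v = r")
        case False
        then have "(Suc v, Suc (f v)) \<in> parcs T" using v by (auto simp: arcs)
        then show ?thesis using ET False by (auto simp: succs_def)
      qed (use r in \<open>simp add: f_def\<close>)
    qed (simp add: f_def)
    have fn: "f v < n" if "v < n" for v
    proof (cases "v = r")
      case False
      then have "(Suc v, Suc (f v)) \<in> parcs T" using that by (auto simp: arcs)
      then show ?thesis using wf(2) by force
    qed (use r in \<open>simp add: f_def\<close>)
    have "\<exists>k. (f ^^ k) v = r" if v: "v < n" for v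
    proof (rule ccontr)
      assume nr: "\<nexists>k. (f ^^ k) v = r"
      have orb: "(f ^^ k) v < n" for k
        by (induction k) (auto simp: v fn)
      then have "range (\<lambda>k. (f ^^ k) v) \<subseteq> {0..<n}" by auto
      then have "\<not> inj (\<lambda>k. (f ^^ k) v)"
        using finite_subset range_inj_infinite by blast
      then obtain k l where "k < l" "(f ^^ k) v = (f ^^ l) v"
        by (metis (mono_tags, lifting) injI linorder_neqE_nat)
      moreover define p where "p = map (\<lambda>i. (Suc ((f ^^ i) v), Suc ((f ^^ Suc i) v))) [k..<l]"
      ultimately have "pcas (Suc ((f ^^ k) v)) p (Suc ((f ^^ k) v))" "p \<noteq> []"
        using pcas_orbit[of k l f v] by auto
      \<comment> \<open>The orbit never visits \<open>r\<close>, the only index without an arc in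
        \<open>T\<close>.\<close>
      moreover have "set p \<subseteq> parcs T"
        using orb nr by (auto simp: p_def arcs)
      ultimately show False
        using acyc[of "Suc ((f ^^ k) v)" p] orb[of k] V by auto
    qed
    with fS T show "T \<in> tree_of n r ` ?F" by blast
  qed
qed

section \<open>Shifted submatrices, one-by-one matrices and entries of products\<close>

lemma submatrix_add_const:
  fixes A :: "'a :: comm_ring_1 mat"
  assumes "A \<in> carrier_mat n n" "I \<subseteq> {0..<n}" "J \<subseteq> {0..<n}"
  shows "submatrix (mat n n (\<lambda>(i, j). A $$ (i, j) + t)) I J =
         mat (card I) (card J) (\<lambda>(i, j). submatrix A I J $$ (i, j) + t)"
  using assms by (auto simp: submatrix_finite[where nr = n and nc = n] pick_less intro!: eq_matI)

lemma cofsum_single: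
  assumes "B \<in> carrier_mat 1 1"
  shows "cofsum B = 1"
  using cofsum_eq_det_diff[OF assms] assms by (simp add: det_single)

lemma mult_mat_entry:
  assumes "A \<in> carrier_mat n n" "B \<in> carrier_mat n n" "i < n" "j < n"
  shows "(A * B) $$ (i, j) = (\<Sum>k<n. A $$ (i, k) * B $$ (k, j))"
  using assms by (simp add: scalar_prod_def lessThan_atLeast0)

section \<open>Resistance matrices of balanced digraphs\<close>

text \<open>The orthogonal projection onto the vectors with zero sum; it is the common value of
  \<open>L * X\<close> and \<open>X * L\<close> for the Moore-Penrose inverse
  \<open>X\<close>.\<close>

definition centering_mat :: "nat \<Rightarrow> real mat" where
  "centering_mat n = mat n n (\<lambda>(i, j). of_bool (i = j) - 1 / real n)"

text \<open>The all-ones matrix annihilates a matrix with zero column sums.\<close>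

lemma centering_mat_mult:
  assumes A: "A \<in> carrier_mat n n" and col: "\<And>j. j < n \<Longrightarrow> (\<Sum>i<n. A $$ (i, j)) = 0"
  shows "centering_mat n * A = A"
proof (rule eq_matI)
  fix i j assume "i < dim_row A" "j < dim_col A"
  then have ij: "i < n" "j < n" using A by auto
  have "(centering_mat n * A) $$ (i, j) = (\<Sum>k<n. (of_bool (i = k) - 1 / real n) * A $$ (k, j))"
    using A ij by (subst mult_mat_entry) (auto simp: centering_mat_def)
  also have "\<dots> = (\<Sum>k<n. if k = i then A $$ (k, j) else 0) - 1 / real n * (\<Sum>k<n. A $$ (k, j))"
    unfolding sum_distrib_left sum_subtractf[symmetric]
    by (intro sum.cong) (auto simp: algebra_simps)
  finally show "(centering_mat n * A) $$ (i, j) = A $$ (i, j)"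
    using ij col by simp
qed (use A in \<open>auto simp: centering_mat_def\<close>)

locale balanced_network =
  fixes G :: "nat pair_pre_digraph" and n :: nat
  assumes digraph: "pair_digraph G"
    and verts: "pverts G = {1..n}"
    and strong: "strongly_connected G"
    and bal: "balanced G"
begin

abbreviation L :: "real mat" where "L \<equiv> laplacian G"

lemma wf: "pair_wf_digraph G"
  using digraph by (simp add: pair_digraph_def pair_fin_digraph_def)

lemma arcs_subset: "parcs G \<subseteq> {1..n} \<times> {1..n}"
  using pair_wf_digraph.in_arcsD1[OF wf] pair_wf_digraph.in_arcsD2[OF wf] verts by auto

text \<open>Strong connectivity includes that the vertex set is nonempty.\<close>

lemma n_pos: "n > 0"
  using strong verts by (cases n) (auto simp: strongly_connected_def)

lemma succs_subset: "succs G i \<subseteq> {0..<n}"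
  using arcs_subset by (auto simp: succs_def)

lemma succsD: "w \<in> succs G i \<Longrightarrow> w < n"
  using succs_subset[of i] by auto

lemma finite_succs [simp]: "finite (succs G i)"
  using succs_subset by (rule finite_subset) simp

section \<open>Entries, row sums, column sums and kernel of the Laplacian\<close>

lemma laplacian_entry:
  assumes "i < n" "j < n"
  shows "L $$ (i, j) = of_bool (i = j) * real (card (succs G i)) - of_bool (j \<in> succs G i)"
proof -
  have "{j \<in> {0..<n}. (Suc i, Suc j) \<in> parcs G} = succs G i"
    using succsD by (auto simp: succs_def)
  then have "(\<Sum>j = 0..<n. if (Suc i, Suc j) \<in> parcs G then 1 else 0 :: real) = real (card (succs G i))"
    by (simp add: sum.If_cases Int_def)
  then show ?thesis
    using assms
    by (auto simp: laplacian_def Let_def adjacency_matrix_def verts ones_vec_def mat_diag_def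
        scalar_prod_def succs_def)
qed

lemma laplacian_carrier [simp]: "L \<in> carrier_mat n n"
  by (intro carrier_matI) (simp_all add: laplacian_def Let_def adjacency_matrix_def verts)

lemma laplacian_dim [simp]: "dim_row L = n" "dim_col L = n"
  using laplacian_carrier by blast+

text \<open>Row \<open>i\<close> as a sum over outgoing arcs, the shape that is expanded over
  choices of arcs.\<close>

lemma laplacian_eq:
  "L = mat n n (\<lambda>(i, j). \<Sum>w\<in>succs G i. of_bool (i = j) - of_bool (w = j))"
proof (rule eq_matI)
  fix i j assume "i < dim_row (mat n n (\<lambda>(i, j). \<Sum>w\<in>succs G i. of_bool (i = j) - of_bool (w = j)) :: real mat)"
    and "j < dim_col (mat n n (\<lambda>(i, j). \<Sum>w\<in>succs G i. of_bool (i = j) - of_bool (w = j)) :: real mat)"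
  then have ij: "i < n" "j < n" by auto
  have "(\<Sum>w\<in>succs G i. of_bool (w = j)) = (of_bool (j \<in> succs G i) :: real)"
    by (simp add: of_bool_def)
  then show "L $$ (i, j) = mat n n (\<lambda>(i, j). \<Sum>w\<in>succs G i. of_bool (i = j) - of_bool (w = j)) $$ (i, j)"
    using ij by (simp add: laplacian_entry sum_subtractf)
qed auto

lemma laplacian_mult:
  fixes x :: "nat \<Rightarrow> real"
  assumes i: "i < n"
  shows "(\<Sum>j<n. L $$ (i, j) * x j) = (\<Sum>w\<in>succs G i. x i - x w)"
proof -
  have "(\<Sum>j<n. L $$ (i, j) * x j) =
      (\<Sum>j<n. if j = i then real (card (succs G i)) * x j else 0)
      - (\<Sum>j<n. if j \<in> succs G i then x j else 0)"
    unfolding sum_subtractf[symmetric]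
    using i by (intro sum.cong) (auto simp: laplacian_entry algebra_simps)
  also have "(\<Sum>j<n. if j \<in> succs G i then x j else 0) = (\<Sum>j\<in>succs G i. x j)"
    using succsD by (intro sum.mono_neutral_cong_right) auto
  finally show ?thesis
    using i by (simp add: sum_subtractf)
qed

lemma row_sum: "i < n \<Longrightarrow> (\<Sum>j<n. L $$ (i, j)) = 0"
  using laplacian_mult[of i "\<lambda>_. 1"] by simp

text \<open>Balance enters here: the sum of column \<open>j\<close> is outdegree minus
  indegree.\<close>

lemma col_sum:
  assumes j: "j < n"
  shows "(\<Sum>i<n. L $$ (i, j)) = 0"
proof -
  have "out_arcs (with_proj G) (Suc j) = (\<lambda>w. (Suc j, Suc w)) ` succs G j"
  proof (intro equalityI subsetI)
    fix e assume "e \<in> out_arcs (with_proj G) (Suc j)"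
    then obtain b where e: "e = (Suc j, b)" "(Suc j, b) \<in> parcs G" by (cases e) auto
    moreover from e arcs_subset obtain w where "b = Suc w" by (cases b) auto
    ultimately show "e \<in> (\<lambda>w. (Suc j, Suc w)) ` succs G j" by (auto simp: succs_def)
  qed (auto simp: succs_def)
  then have out: "out_degree (with_proj G) (Suc j) = card (succs G j)"
    by (simp add: out_degree_def card_image inj_on_def)
  have "in_arcs (with_proj G) (Suc j) = (\<lambda>w. (Suc w, Suc j)) ` {i \<in> {..<n}. j \<in> succs G i}"
  proof (intro equalityI subsetI)
    fix e assume "e \<in> in_arcs (with_proj G) (Suc j)"
    then obtain a where e: "e = (a, Suc j)" "(a, Suc j) \<in> parcs G" by (cases e) auto
    moreover from e arcs_subset obtain w where "a = Suc w" "w < n" by (cases a) auto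
    ultimately show "e \<in> (\<lambda>w. (Suc w, Suc j)) ` {i \<in> {..<n}. j \<in> succs G i}"
      by (auto simp: succs_def)
  qed (auto simp: succs_def)
  then have "in_degree (with_proj G) (Suc j) = card {i \<in> {..<n}. j \<in> succs G i}"
    by (simp add: in_degree_def card_image inj_on_def)
  with out have bal_j: "card (succs G j) = card {i \<in> {..<n}. j \<in> succs G i}"
    using bal verts j by (simp add: balanced_def)
  have "(\<Sum>i<n. L $$ (i, j)) =
      (\<Sum>i<n. if i = j then real (card (succs G i)) else 0)
      - (\<Sum>i<n. if j \<in> succs G i then 1 else 0)"
    unfolding sum_subtractf[symmetric]
    using j by (intro sum.cong) (auto simp: laplacian_entry)
  also have "\<dots> = 0"
    using j bal_j by (simp add: sum.If_cases Int_def)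
  finally show ?thesis .
qed

text \<open>Maximum principle: the set where a harmonic function is maximal is closed under arcs.\<close>

lemma harmonic_const:
  fixes x :: "nat \<Rightarrow> real"
  assumes harm: "\<And>i. i < n \<Longrightarrow> (\<Sum>j<n. L $$ (i, j) * x j) = 0" and ij: "i < n" "j < n"
  shows "x i = x j"
proof -
  have fin: "finite (x ` {..<n})" "x ` {..<n} \<noteq> {}" using n_pos by auto
  define m where "m = Max (x ` {..<n})"
  have le: "x k \<le> m" if "k < n" for k
    unfolding m_def using that fin by (intro Max_ge) auto
  obtain k0 where k0: "k0 < n" "x k0 = m"
    using Max_in[OF fin] by (auto simp: m_def)
  \<comment> \<open>At a maximum all differences \<open>x v - x w\<close> are nonnegative and sum to
    zero, so each of them vanishes.\<close>
  have closed: "x w = m" if v: "v < n" "x v = m" and w: "w \<in> succs G v" for v w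
  proof -
    have "(\<Sum>w\<in>succs G v. x v - x w) = 0"
      using harm[OF v(1)] laplacian_mult[OF v(1)] by simp
    moreover have "0 \<le> x v - x w" if "w \<in> succs G v" for w
      using le[OF succsD[OF that]] v by simp
    ultimately show ?thesis
      using w v by (subst (asm) sum_nonneg_eq_0_iff) auto
  qed
  \<comment> \<open>Strong connectivity gives a path from a maximal vertex to \<open>k\<close>,
    along which the maximum propagates.\<close>
  have "x (k - 1) = m" if "k \<in> {1..n}" for k
  proof -
    have "(Suc k0, k) \<in> rtrancl_on {1..n} (parcs G)"
      using strong k0 that by (simp add: strongly_connected_def reachable_def verts)
    then show ?thesis
    proof (induction rule: rtrancl_on_induct)
      case base
      then show ?case using k0 by simp
    next
      case (step u v)
      then have "Suc (u - 1) = u" "Suc (v - 1) = v" "u - 1 < n" by auto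
      then show ?case using step closed[of "u - 1" "v - 1"] by (simp add: succs_def)
    qed
  qed
  from this[of "Suc i"] this[of "Suc j"] show ?thesis using ij by simp
qed

section \<open>Nonvanishing of the cofactor sum of the Laplacian\<close>

lemma det_laplacian: "det L = 0"
proof -
  have "L *\<^sub>v vec n (\<lambda>_. 1) = 0\<^sub>v n"
    using row_sum by (intro eq_vecI) (auto simp: scalar_prod_def lessThan_atLeast0)
  moreover have "vec n (\<lambda>_. 1) \<noteq> (0\<^sub>v n :: real vec)"
    using n_pos by (auto dest: arg_cong[of _ _ "\<lambda>v. v $ 0"])
  ultimately show ?thesis
    using det_0_iff_vec_prod_zero_field[OF laplacian_carrier] vec_carrier by blast
qed

text \<open>For a kernel vector \<open>v\<close>, adding all equations removes the Laplacian part by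
  the zero column sums, so \<open>v\<close> has sum zero. Then \<open>v\<close> is harmonic, hence
  constant, hence zero.\<close>

lemma det_laplacian_add_one: "det (mat n n (\<lambda>(i, j). L $$ (i, j) + 1)) \<noteq> 0"
proof
  let ?M = "mat n n (\<lambda>(i, j). L $$ (i, j) + 1)"
  assume "det ?M = 0"
  then obtain v where v: "v \<in> carrier_vec n" "v \<noteq> 0\<^sub>v n" "?M *\<^sub>v v = 0\<^sub>v n"
    using det_0_iff_vec_prod_zero_field[of ?M n] by auto
  have eq: "(\<Sum>j<n. L $$ (i, j) * v $ j) + (\<Sum>j<n. v $ j) = 0" if "i < n" for i
  proof -
    have "(?M *\<^sub>v v) $ i = (\<Sum>j<n. (L $$ (i, j) + 1) * v $ j)"
      using v(1) that by (simp add: scalar_prod_def lessThan_atLeast0)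
    also have "\<dots> = (\<Sum>j<n. L $$ (i, j) * v $ j) + (\<Sum>j<n. v $ j)"
      by (simp add: distrib_right sum.distrib)
    finally show ?thesis using v(3) that by simp
  qed
  have "0 = (\<Sum>i<n. (\<Sum>j<n. L $$ (i, j) * v $ j) + (\<Sum>j<n. v $ j))"
    using eq by simp
  also have "\<dots> = (\<Sum>i<n. \<Sum>j<n. L $$ (i, j) * v $ j) + real n * (\<Sum>j<n. v $ j)"
    by (simp add: sum.distrib)
  also have "(\<Sum>i<n. \<Sum>j<n. L $$ (i, j) * v $ j) = (\<Sum>j<n. (\<Sum>i<n. L $$ (i, j)) * v $ j)"
    unfolding sum_distrib_right by (rule sum.swap)
  also have "\<dots> = 0" by (simp add: col_sum)
  finally have sum0: "(\<Sum>j<n. v $ j) = 0" using n_pos by simp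
  have "(\<Sum>j<n. L $$ (i, j) * v $ j) = 0" if "i < n" for i
    using eq[OF that] sum0 by simp
  note const = harmonic_const[OF this]
  have "v $ i = 0" if "i < n" for i
  proof -
    have "(\<Sum>j<n. v $ j) = (\<Sum>j<n. v $ i)"
      by (intro sum.cong refl const) (simp_all add: that)
    then show ?thesis using sum0 n_pos by simp
  qed
  then have "v = 0\<^sub>v n" using v(1) by (intro eq_vecI) auto
  with v(2) show False by simp
qed

text \<open>As \<open>det L = 0\<close>, the cofactor sum is the determinant of \<open>L\<close>
  with 1 added to every entry.\<close>

lemma cofsum_laplacian: "cofsum L \<noteq> 0"
  using cofsum_eq_det_diff[OF laplacian_carrier] det_laplacian det_laplacian_add_one by simp

section \<open>The Moore-Penrose inverse of the Laplacian and its minors\<close>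

text \<open>The inverse \<open>N\<close> of \<open>L\<close> plus the all-ones matrix has all row
  and column sums \<open>1 / n\<close>. Subtracting a constant from its entries gives
  \<open>Y\<close> with \<open>L * Y = Y * L\<close> equal to the symmetric centering projection,
  from which the Penrose conditions follow.\<close>

lemma moore_penrose_laplacian:
  defines "X \<equiv> moore_penrose L"
  shows "X \<in> carrier_mat n n" and "L * X = centering_mat n"
    and "\<And>j. j < n \<Longrightarrow> (\<Sum>i<n. X $$ (i, j)) = 0"
proof -
  define M where "M = mat n n (\<lambda>(i, j). L $$ (i, j) + 1)"
  have M: "M \<in> carrier_mat n n" by (simp add: M_def)
  have Mij: "M $$ (i, j) = L $$ (i, j) + 1" if "i < n" "j < n" for i j
    using that by (simp add: M_def)
  have d: "det M \<noteq> 0" using det_laplacian_add_one by (simp add: M_def)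
  define N where "N = (1 / det M) \<cdot>\<^sub>m adj_mat M"
  have N: "N \<in> carrier_mat n n" using adj_mat(1)[OF M] by (simp add: N_def)
  have unit: "(1 / det M) \<cdot>\<^sub>m (det M \<cdot>\<^sub>m 1\<^sub>m n) = 1\<^sub>m n"
    using d by (intro eq_matI) auto
  have "M * N = 1\<^sub>m n"
    unfolding N_def using mult_smult_distrib[OF M adj_mat(1)[OF M]] adj_mat(2)[OF M] unit by simp
  then have MN: "(\<Sum>k<n. M $$ (i, k) * N $$ (k, j)) = of_bool (i = j)" if "i < n" "j < n" for i j
    using mult_mat_entry[OF M N that] that by (auto split: if_splits)
  have "N * M = 1\<^sub>m n"
    unfolding N_def using mult_smult_assoc_mat[OF adj_mat(1)[OF M] M] adj_mat(3)[OF M] unit by simp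
  then have NM: "(\<Sum>k<n. N $$ (i, k) * M $$ (k, j)) = of_bool (i = j)" if "i < n" "j < n" for i j
    using mult_mat_entry[OF N M that] that by (auto split: if_splits)
  have Mrow: "(\<Sum>j<n. M $$ (i, j)) = real n" if "i < n" for i
    using that row_sum by (simp add: Mij sum.distrib)
  have Mcol: "(\<Sum>i<n. M $$ (i, j)) = real n" if "j < n" for j
    using that col_sum by (simp add: Mij sum.distrib)
  have Ncol: "(\<Sum>k<n. N $$ (k, j)) = 1 / real n" if j: "j < n" for j
  proof -
    have "1 = (\<Sum>i<n. \<Sum>k<n. M $$ (i, k) * N $$ (k, j))"
      using j by (simp add: MN of_bool_def)
    also have "\<dots> = (\<Sum>k<n. (\<Sum>i<n. M $$ (i, k)) * N $$ (k, j))"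
      unfolding sum_distrib_right by (rule sum.swap)
    also have "\<dots> = real n * (\<Sum>k<n. N $$ (k, j))"
      by (simp add: Mcol sum_distrib_left)
    finally show ?thesis using n_pos by (simp add: field_simps)
  qed
  have Nrow: "(\<Sum>k<n. N $$ (i, k)) = 1 / real n" if i: "i < n" for i
  proof -
    have "1 = (\<Sum>j<n. \<Sum>k<n. N $$ (i, k) * M $$ (k, j))"
      using i by (simp add: NM of_bool_def)
    also have "\<dots> = (\<Sum>k<n. N $$ (i, k) * (\<Sum>j<n. M $$ (k, j)))"
      unfolding sum_distrib_left by (rule sum.swap)
    also have "\<dots> = real n * (\<Sum>k<n. N $$ (i, k))"
      by (simp add: Mrow sum_distrib_left mult.commute)
    finally show ?thesis using n_pos by (simp add: field_simps)
  qed
  \<comment> \<open>Chosen so that the column sums \<open>1 / n - n * c\<close> of \<open>Y\<close>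
    vanish.\<close>
  define c where "c = 1 / (real n)\<^sup>2"
  define Y where "Y = mat n n (\<lambda>(i, j). N $$ (i, j) - c)"
  have Y: "Y \<in> carrier_mat n n" by (simp add: Y_def)
  have Yij: "Y $$ (i, j) = N $$ (i, j) - c" if "i < n" "j < n" for i j
    using that by (simp add: Y_def)
  have Ycol: "(\<Sum>i<n. Y $$ (i, j)) = 0" if "j < n" for j
    using that n_pos by (simp add: Yij sum_subtractf Ncol c_def power2_eq_square)
  have LY: "L * Y = centering_mat n"
  proof (rule eq_matI)
    fix i j assume "i < dim_row (centering_mat n)" "j < dim_col (centering_mat n)"
    then have ij: "i < n" "j < n" by (auto simp: centering_mat_def)
    have "(L * Y) $$ (i, j) = (\<Sum>k<n. (M $$ (i, k) - 1) * (N $$ (k, j) - c))"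
      using ij by (simp add: mult_mat_entry[OF laplacian_carrier Y] Mij Yij)
    also have "\<dots> = (\<Sum>k<n. M $$ (i, k) * N $$ (k, j)) - c * (\<Sum>k<n. M $$ (i, k))
        - (\<Sum>k<n. N $$ (k, j)) + real n * c"
      by (simp add: algebra_simps sum.distrib sum_subtractf sum_distrib_left)
    finally show "(L * Y) $$ (i, j) = centering_mat n $$ (i, j)"
      using ij n_pos by (simp add: MN Mrow Ncol centering_mat_def c_def power2_eq_square)
  qed (use Y laplacian_carrier in \<open>auto simp: centering_mat_def\<close>)
  have YL: "Y * L = centering_mat n"
  proof (rule eq_matI)
    fix i j assume "i < dim_row (centering_mat n)" "j < dim_col (centering_mat n)"
    then have ij: "i < n" "j < n" by (auto simp: centering_mat_def)
    have "(Y * L) $$ (i, j) = (\<Sum>k<n. (N $$ (i, k) - c) * (M $$ (k, j) - 1))"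
      using ij by (simp add: mult_mat_entry[OF Y laplacian_carrier] Mij Yij)
    also have "\<dots> = (\<Sum>k<n. N $$ (i, k) * M $$ (k, j)) - c * (\<Sum>k<n. M $$ (k, j))
        - (\<Sum>k<n. N $$ (i, k)) + real n * c"
      by (simp add: algebra_simps sum.distrib sum_subtractf sum_distrib_left)
    finally show "(Y * L) $$ (i, j) = centering_mat n $$ (i, j)"
      using ij n_pos by (simp add: NM Mcol Nrow centering_mat_def c_def power2_eq_square)
  qed (use Y laplacian_carrier in \<open>auto simp: centering_mat_def\<close>)
  have "transpose_mat (centering_mat n) = centering_mat n"
    by (auto simp: centering_mat_def intro!: eq_matI)
  moreover have "centering_mat n * L = L"
    by (rule centering_mat_mult) (auto simp: col_sum)
  moreover have "centering_mat n * Y = Y"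
    by (rule centering_mat_mult[OF Y]) (auto simp: Ycol)
  ultimately have "is_moore_penrose L Y"
    using Y laplacian_carrier by (auto simp: is_moore_penrose_def LY YL)
  then have "X = Y" unfolding X_def by (rule moore_penrose_eqI)
  then show "X \<in> carrier_mat n n" "L * X = centering_mat n"
    "\<And>j. j < n \<Longrightarrow> (\<Sum>i<n. X $$ (i, j)) = 0"
    using Y LY Ycol by auto
qed

text \<open>The mixed terms vanish by the zero row sums of \<open>L\<close> and the zero column sums
  of its inverse. The product of the two shifts contributes \<open>1 / n\<close> to each entry,
  which completes the centering matrix to the identity.\<close>

lemma laplacian_shift_inverse:
  assumes s: "s \<noteq> 0"
  shows "mat n n (\<lambda>(i, j). L $$ (i, j) + s)
       * mat n n (\<lambda>(i, j). moore_penrose L $$ (i, j) + 1 / (s * (real n)\<^sup>2)) = 1\<^sub>m n"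
    (is "?M * ?N = _")
proof (rule eq_matI)
  let ?X = "moore_penrose L" and ?t = "1 / (s * (real n)\<^sup>2)"
  note X = moore_penrose_laplacian
  fix i j assume "i < dim_row (1\<^sub>m n :: real mat)" "j < dim_col (1\<^sub>m n :: real mat)"
  then have ij: "i < n" "j < n" by auto
  have "(?M * ?N) $$ (i, j) = (\<Sum>k<n. (L $$ (i, k) + s) * (?X $$ (k, j) + ?t))"
    using ij by (subst mult_mat_entry) auto
  also have "\<dots> = (\<Sum>k<n. L $$ (i, k) * ?X $$ (k, j)) + (\<Sum>k<n. L $$ (i, k)) * ?t
      + s * (\<Sum>k<n. ?X $$ (k, j)) + real n * (s * ?t)"
    by (simp only: distrib_left distrib_right sum.distrib sum_distrib_left sum_distrib_right
        sum_constant card_lessThan add.assoc)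
  also have "(\<Sum>k<n. L $$ (i, k) * ?X $$ (k, j)) = of_bool (i = j) - 1 / real n"
    using mult_mat_entry[OF laplacian_carrier X(1) ij] X(2) ij by (simp add: centering_mat_def)
  finally show "(?M * ?N) $$ (i, j) = 1\<^sub>m n $$ (i, j)"
    using ij s n_pos X(3) row_sum by (simp add: power2_eq_square)
qed auto

text \<open>Jacobi's identity for \<open>L + s J\<close> is affine in \<open>s\<close> on both sides; comparing the constant terms,
  which the values at \<open>s = 1\<close> and \<open>s = 2\<close> determine, gives the claim.\<close>

lemma cofsum_moore_penrose_minor:
  assumes I: "I \<subseteq> {0..<n}" and J: "J \<subseteq> {0..<n}" and IJ: "card I = card J"
  shows "cofsum L / (real n)\<^sup>2 * cofsum (submatrix (moore_penrose L) I J) =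
         (- 1) ^ (\<Sum>I + \<Sum>J) * det (submatrix L ({0..<n} - J) ({0..<n} - I))"
proof -
  let ?X' = "submatrix (moore_penrose L) I J"
  let ?L' = "submatrix L ({0..<n} - J) ({0..<n} - I)"
  define \<sigma> :: real where "\<sigma> = (- 1) ^ (\<Sum>I + \<Sum>J)"
  note X = moore_penrose_laplacian(1)
  have I': "{0..<n} - I \<subseteq> {0..<n}" and J': "{0..<n} - J \<subseteq> {0..<n}" by auto
  have c: "card ({0..<n} - I) = card ({0..<n} - J)"
    using I J IJ by (simp add: card_Diff_subset finite_subset)
  have X': "?X' \<in> carrier_mat (card I) (card I)"
    by (simp add: submatrix_finite[OF X I J] IJ)
  have L': "?L' \<in> carrier_mat (card ({0..<n} - J)) (card ({0..<n} - J))"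
    by (simp add: submatrix_finite[OF laplacian_carrier J' I'] c)
  have key: "(det ?X' + 1 / (s * (real n)\<^sup>2) * cofsum ?X') * (s * cofsum L) =
      \<sigma> * (det ?L' + s * cofsum ?L')" if s: "s \<noteq> 0" for s
  proof -
    let ?M = "mat n n (\<lambda>(i, j). L $$ (i, j) + s)"
    let ?N = "mat n n (\<lambda>(i, j). moore_penrose L $$ (i, j) + 1 / (s * (real n)\<^sup>2))"
    have "det (submatrix ?N I J) * det ?M =
        \<sigma> * det (submatrix ?M ({0..<n} - J) ({0..<n} - I))"
      unfolding \<sigma>_def
      by (rule jacobi_complementary_minor[OF _ _ laplacian_shift_inverse[OF s] I J IJ]) auto
    moreover have "det ?M = s * cofsum L"
      by (simp add: det_add_const[OF laplacian_carrier] det_laplacian)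
    moreover have "det (submatrix ?N I J) = det ?X' + 1 / (s * (real n)\<^sup>2) * cofsum ?X'"
      unfolding submatrix_add_const[OF X I J] IJ[symmetric] by (rule det_add_const[OF X'])
    moreover have "det (submatrix ?M ({0..<n} - J) ({0..<n} - I)) = det ?L' + s * cofsum ?L'"
      unfolding submatrix_add_const[OF laplacian_carrier J' I'] c by (rule det_add_const[OF L'])
    ultimately show ?thesis by simp
  qed
  \<comment> \<open>For an affine function \<open>F\<close> of \<open>s\<close>, the constant term
    is \<open>2 * F 1 - F 2\<close>.\<close>
  have "cofsum L / (real n)\<^sup>2 * cofsum ?X' =
      2 * ((det ?X' + 1 / (1 * (real n)\<^sup>2) * cofsum ?X') * (1 * cofsum L))
      - (det ?X' + 1 / (2 * (real n)\<^sup>2) * cofsum ?X') * (2 * cofsum L)"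
    using n_pos by (simp add: field_simps)
  also have "\<dots> = \<sigma> * det ?L'"
    using key[of 1] key[of 2] by (simp add: algebra_simps)
  finally show ?thesis by (simp add: \<sigma>_def)
qed

lemma principal_minor_laplacian:
  assumes r: "r < n"
  shows "det (submatrix L ({0..<n} - {r}) ({0..<n} - {r})) = cofsum L / (real n)\<^sup>2"
proof -
  have "submatrix (moore_penrose L) {r} {r} \<in> carrier_mat 1 1"
    using r by (subst submatrix_finite[OF moore_penrose_laplacian(1)]) auto
  then have "cofsum (submatrix (moore_penrose L) {r} {r}) = 1"
    by (rule cofsum_single)
  then show ?thesis
    using cofsum_moore_penrose_minor[of "{r}" "{r}"] r by simp
qed

section \<open>The tree count and resistance minors\<close>

lemma card_oriented_spanning_tree:
  assumes r: "r < n"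
  shows "real (card {T. oriented_spanning_tree G (Suc r) T}) = cofsum L / (real n)\<^sup>2"
  using det_principal_minor_eq_card[OF _ r laplacian_eq] succs_subset
    bij_betw_same_card[OF tree_of_bij_betw[OF wf verts r]] principal_minor_laplacian[OF r] by simp

text \<open>The counts at all roots agree, which makes the definite description in
  \<open>kappa\<close> well defined.\<close>

lemma real_kappa: "real (kappa G) = cofsum L / (real n)\<^sup>2"
proof -
  define k where "k = card {T. oriented_spanning_tree G (Suc 0) T}"
  have k: "real k = cofsum L / (real n)\<^sup>2"
    unfolding k_def by (rule card_oriented_spanning_tree[OF n_pos])
  have all: "card {T. oriented_spanning_tree G r T} = k" if "r \<in> pverts G" for r
  proof -
    have "r = Suc (r - 1)" "r - 1 < n" using that verts by auto
    then have "real (card {T. oriented_spanning_tree G r T}) = real k"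
      using card_oriented_spanning_tree[of "r - 1"] k by simp
    then show ?thesis by simp
  qed
  have "kappa G = k"
    unfolding kappa_def
  proof (rule the_equality)
    show "\<forall>r\<in>pverts G. card {T. oriented_spanning_tree G r T} = k" using all by blast
  next
    fix k' assume "\<forall>r\<in>pverts G. card {T. oriented_spanning_tree G r T} = k'"
    \<comment> \<open>One vertex suffices to determine \<open>k'\<close>; over an empty vertex set
      every number would qualify.\<close>
    moreover have "1 \<in> pverts G" using n_pos verts by simp
    ultimately show "k' = k" using all by metis
  qed
  with k show ?thesis by simp
qed

lemma kappa_nonzero: "real (kappa G) \<noteq> 0"
  unfolding real_kappa using cofsum_laplacian n_pos by simp

text \<open>The diagonal terms of the resistance shift rows and columns by constants, which leaves the
  cofactor sum unchanged.\<close>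

lemma cofsum_resistance_minor:
  assumes I: "I \<subseteq> {0..<n}" and J: "J \<subseteq> {0..<n}" and IJ: "card I = card J" and ne: "card I > 0"
  shows "cofsum (submatrix (resistance_matrix G) I J) =
         (- 2) ^ (card I - 1) * cofsum (submatrix (moore_penrose L) I J)"
proof -
  let ?X = "moore_penrose L" and ?k = "card I"
  let ?X' = "submatrix ?X I J"
  have X': "?X' = mat ?k ?k (\<lambda>(i, j). ?X $$ (pick I i, pick J j))"
    by (simp add: submatrix_finite[OF moore_penrose_laplacian(1) I J] IJ)
  have R: "resistance_matrix G \<in> carrier_mat n n" by (simp add: resistance_matrix_def verts)
  \<comment> \<open>\<open>B\<close> carries the diagonal term belonging to the row; the one
    belonging to the column is added next.\<close>
  define B where "B = mat ?k ?k (\<lambda>(i, j). (- 2 \<cdot>\<^sub>m ?X') $$ (i, j) + ?X $$ (pick I i, pick I i))"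
  have "submatrix (resistance_matrix G) I J = mat ?k ?k (\<lambda>(i, j). B $$ (i, j) + ?X $$ (pick J j, pick J j))"
    unfolding submatrix_finite[OF R I J] IJ[symmetric]
    using I J IJ
    by (intro eq_matI) (auto simp: B_def X' resistance_matrix_def resistance_def Let_def verts pick_less)
  then have "cofsum (submatrix (resistance_matrix G) I J) = cofsum B"
    by (simp add: cofsum_add_col_const B_def)
  also have "\<dots> = cofsum (- 2 \<cdot>\<^sub>m ?X')"
    unfolding B_def by (rule cofsum_add_row_const) (simp add: X')
  also have "\<dots> = (- 2) ^ (?k - 1) * cofsum ?X'"
    by (rule cofsum_smult[OF _ ne]) (simp add: X')
  finally show ?thesis .
qed

section \<open>From matrix indices to vertices, and pairs of opposite resistances\<close>

lemma cofsum_resistance: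
  assumes \<Omega>1: "\<Omega>1 \<subseteq> {1..n}" and \<Omega>2: "\<Omega>2 \<subseteq> {1..n}" and ne: "\<Omega>1 \<noteq> {}"
    and \<eta>: "card \<Omega>1 = \<eta>" "card \<Omega>2 = \<eta>"
  shows "cofsum (vsubmatrix (resistance_matrix G) \<Omega>1 \<Omega>2) =
     (- 1) ^ (\<Sum>\<Omega>1 + \<Sum>\<Omega>2 + \<eta> - 1) * (2 ^ (\<eta> - 1) / real (kappa G)) *
     det (vsubmatrix L ({1..n} - \<Omega>2) ({1..n} - \<Omega>1))"
proof -
  define I J where "I = {i. Suc i \<in> \<Omega>1}" and "J = {j. Suc j \<in> \<Omega>2}"
  have shift: "S = Suc ` {i. Suc i \<in> S}" if "S \<subseteq> {1..n}" for S
  proof (intro equalityI subsetI)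
    fix x assume "x \<in> S"
    with that have "x = Suc (x - 1)" by auto
    with \<open>x \<in> S\<close> show "x \<in> Suc ` {i. Suc i \<in> S}" by (metis imageI mem_Collect_eq)
  qed auto
  have sumcard: "\<Sum>S = \<Sum>{i. Suc i \<in> S} + card S" "card S = card {i. Suc i \<in> S}"
    if "S \<subseteq> {1..n}" for S
  proof -
    let ?I = "{i. Suc i \<in> S}"
    have "?I \<subseteq> {0..<n}" using that by auto
    then have "finite ?I" by (rule finite_subset) simp
    show card: "card S = card ?I" using shift[OF that] by (metis card_image inj_Suc)
    have "\<Sum>S = \<Sum>(Suc ` ?I)" by (rule arg_cong[OF shift[OF that]])
    also have "\<dots> = (\<Sum>i\<in>?I. Suc i)" by (simp add: sum.reindex)
    also have "\<dots> = \<Sum>?I + card ?I" by (rule sum_Suc)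
    finally show "\<Sum>S = \<Sum>?I + card S" unfolding card .
  qed
  have I: "I \<subseteq> {0..<n}" and J: "J \<subseteq> {0..<n}" using \<Omega>1 \<Omega>2 by (auto simp: I_def J_def)
  have cI: "card I = \<eta>" and cJ: "card J = \<eta>"
    using sumcard(2)[OF \<Omega>1] sumcard(2)[OF \<Omega>2] \<eta> by (auto simp: I_def J_def)
  have "finite \<Omega>1" using \<Omega>1 finite_subset by blast
  then have pos: "\<eta> > 0" using ne \<eta>(1) by (auto simp: card_gt_0_iff)
  have co: "{i. Suc i \<in> {1..n} - S} = {0..<n} - {i. Suc i \<in> S}" for S by auto
  \<comment> \<open>Passing from vertices to indices lowers each of the two sums by
    \<open>\<eta>\<close>, an even change in total. The remaining \<open>\<eta> - 1\<close> signs
    match those of the power of \<open>- 2\<close>.\<close>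
  have "\<Sum>\<Omega>1 + \<Sum>\<Omega>2 + \<eta> - 1 = (\<Sum>I + \<Sum>J) + 2 * \<eta> + (\<eta> - 1)"
    using sumcard(1)[OF \<Omega>1] sumcard(1)[OF \<Omega>2] \<eta> pos by (simp add: I_def J_def)
  then have sign: "(- 1 :: real) ^ (\<Sum>\<Omega>1 + \<Sum>\<Omega>2 + \<eta> - 1) = (- 1) ^ (\<Sum>I + \<Sum>J) * (- 1) ^ (\<eta> - 1)"
    by (simp add: power_add)
  have two: "(- 2 :: real) ^ (\<eta> - 1) = (- 1) ^ (\<eta> - 1) * 2 ^ (\<eta> - 1)"
    by (metis power_minus)
  have "real (kappa G) * cofsum (submatrix (moore_penrose L) I J) =
      (- 1) ^ (\<Sum>I + \<Sum>J) * det (submatrix L ({0..<n} - J) ({0..<n} - I))"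
    unfolding real_kappa using cofsum_moore_penrose_minor[OF I J] cI cJ by simp
  then have "cofsum (submatrix (moore_penrose L) I J) =
      (- 1) ^ (\<Sum>I + \<Sum>J) * det (submatrix L ({0..<n} - J) ({0..<n} - I)) / real (kappa G)"
    using kappa_nonzero by (simp add: field_simps)
  then show ?thesis
    unfolding vsubmatrix_def co sign
    unfolding I_def[symmetric] J_def[symmetric]
    using cofsum_resistance_minor[OF I J] cI cJ pos two by (simp add: field_simps)
qed

lemma resistance_self [simp]: "resistance G i i = 0"
  by (simp add: resistance_def Let_def)

text \<open>The case of both index sets equal to \<open>{i, j}\<close>: a two-by-two matrix with
  zero diagonal has as cofactor sum minus the sum of its off-diagonal entries. The order
  \<open>i < j\<close> makes the enumeration \<open>f\<close> increasing.\<close>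

lemma resistance_add_swap:
  assumes i: "i \<in> {1..n}" and j: "j \<in> {1..n}" and lt: "i < j"
  shows "resistance G i j + resistance G j i =
    2 / real (kappa G) * det (vsubmatrix L ({1..n} - {i, j}) ({1..n} - {i, j}))"
proof -
  let ?I = "{i - 1, j - 1}"
  have Suc: "Suc (i - 1) = i" "Suc (j - 1) = j" using i j by auto
  have R: "resistance_matrix G \<in> carrier_mat n n" by (simp add: resistance_matrix_def verts)
  define f where "f k = (if k = 0 then i - 1 else j - 1)" for k :: nat
  have f: "strict_mono_on {0..<2} f" "f ` {0..<2} = ?I" "?I \<subseteq> {0..<n}"
    using i j lt by (auto simp: f_def strict_mono_on_def numeral_2_eq_2 atLeast0_lessThan_Suc)
  define B where "B = mat 2 2 (\<lambda>(a, b). resistance_matrix G $$ (f a, f b))"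
  have B: "B \<in> carrier_mat 2 2" by (simp add: B_def)
  have entries: "B $$ (0, 0) = 0" "B $$ (0, 1) = resistance G i j"
    "B $$ (1, 0) = resistance G j i" "B $$ (1, 1) = 0"
    using i j Suc by (auto simp: B_def f_def resistance_matrix_def verts)
  have det2: "det C = C $$ (0, 0) * C $$ (1, 1) - C $$ (0, 1) * C $$ (1, 0)"
    if "C \<in> carrier_mat 2 2" for C :: "real mat"
    using laplace_expansion_row[OF that, of 0] that
    by (simp add: numeral_2_eq_2 cofactor_def mat_delete_def det_single)
  have "vsubmatrix (resistance_matrix G) {i, j} {i, j} = B"
  proof -
    have "{k. Suc k \<in> {i, j}} = ?I" using i j by auto
    then show ?thesis
      unfolding vsubmatrix_def B_def using submatrix_enum[OF R f f] by simp
  qed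
  moreover have "cofsum B = - (resistance G i j + resistance G j i)"
    unfolding cofsum_eq_det_diff[OF B]
    by (simp add: det2[OF B] det2 entries[unfolded One_nat_def] algebra_simps)
  moreover have "card {i, j} = 2" using lt by simp
  \<comment> \<open>The exponent is twice \<open>\<Sum>{i, j}\<close> plus 1, hence odd; this sign
    cancels the one in \<open>cofsum B\<close>.\<close>
  moreover have "(- 1 :: real) ^ (\<Sum>{i, j} + \<Sum>{i, j} + 2 - 1) = - 1"
    by simp
  ultimately show ?thesis
    using cofsum_resistance[of "{i, j}" "{i, j}" 2] i j by simp
qed

end

theorem theorem5p5:
  fixes G :: "nat pair_pre_digraph" and n :: nat
  assumes "pair_digraph G"
    and "pverts G = {1..n}"
    and "strongly_connected G"
    and "balanced G"
  shows "(\<forall>\<Omega>1 \<Omega>2 \<eta>. \<Omega>1 \<subseteq> {1..n} \<longrightarrow> \<Omega>2 \<subseteq> {1..n} \<longrightarrow> \<Omega>1 \<noteq> {} \<longrightarrow> \<Omega>2 \<noteq> {} \<longrightarrow>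
            \<eta> = card \<Omega>1 \<longrightarrow> \<eta> = card \<Omega>2 \<longrightarrow>
            cofsum (vsubmatrix (resistance_matrix G) \<Omega>1 \<Omega>2) =
              (- 1) ^ (\<Sum>\<Omega>1 + \<Sum>\<Omega>2 + \<eta> - 1) * (2 ^ (\<eta> - 1) / real (kappa G)) *
              det (vsubmatrix (laplacian G) ({1..n} - \<Omega>2) ({1..n} - \<Omega>1))) \<and>
         (\<forall>i\<in>{1..n}. \<forall>j\<in>{1..n}. i \<noteq> j \<longrightarrow>
            resistance G i j + resistance G j i =
              2 / real (kappa G) *
              det (vsubmatrix (laplacian G) ({1..n} - {i, j}) ({1..n} - {i, j})))"
proof -
  interpret balanced_network G n
    using assms by (rule balanced_network.intro)
  have "resistance G i j + resistance G j i =
      2 / real (kappa G) * det (vsubmatrix (laplacian G) ({1..n} - {i, j}) ({1..n} - {i, j}))"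
    if "i \<in> {1..n}" "j \<in> {1..n}" "i \<noteq> j" for i j
  proof (cases "i < j")
    case True
    then show ?thesis using resistance_add_swap that by blast
  next
    case False
    then show ?thesis
      using resistance_add_swap[of j i] that by (simp add: insert_commute add.commute)
  qed
  then show ?thesis
    by (intro conjI allI ballI impI cofsum_resistance) auto
qed

end
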